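(* Let $N$ be a positive integer. Assume that $x\in I=[0,1)$ and let $x=[a_1,a_2,a_3,\dots]_N$ be the $N$-continued fraction expansion of $x$. (1) Let $$K_N(x)=\lim_{n\to\infty}\sqrt[n]{\prod_{k=1}^n a_k}$$ be the geometric mean of the coefficients. For Lebesgue almost every $x\in I$, $K_N(x)=K_N$ is a constant that depends only on $N$. In particular, $$\lim_{N\to\infty}\frac{K_N}{N}=e.$$ (2) Let $[a_1,\dots,a_n]_N=\dfrac{A_n(x)}{B_n(x)}$ with $A_n(x),B_n(x)$ positive integers (without reduction of the fraction). Then: (i) For Lebesgue almost every $x\in I$, $$\lim_{n\to\infty}\frac1n\ln B_n(x)=L_N(x)=L_N$$ is a constant that depends only on $N$. In particular, $$\lim_{N\to\infty}(L_N-\ln N)=1.$$ (ii) For every $x\in I$, $$\liminf_{n\to\infty}\frac1n\ln B_n(x)\ge \ln\frac{\sqrt{N^2+4N}+N}{2}.$$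
   Context: For a positive integer $N$, $T_N:I\to I$, $I=[0,1)$, is defined by $T_N(0)=0$ and $T_N(x)=\{N/x\}$ (fractional part) for $x\neq0$. The $N$-continued fraction expansion of $x\in I$ is $$x=\cfrac{N}{a_1+\cfrac{N}{a_2+\cfrac{N}{a_3+\ddots}}}=[a_1,a_2,a_3,\dots]_N,$$ where $a_k=\dfrac{N}{T_N^{k-1}(x)}-T_N^k(x)$ is the integer part of $\dfrac{N}{T_N^{k-1}(x)}$ for each $k=1,2,\dots$, and $a_k=\infty$ if $T_N^{k-1}(x)=0$. One has $a_k\ge N$ for all $k$, and some $a_k$ is $\infty$ if and only if $x$ is rational. The finite expression $[a_1,\dots,a_n]_N$ denotes the truncated continued fraction $\cfrac{N}{a_1+\cfrac{N}{\ddots+\cfrac{N}{a_n}}}$, the $n$-th convergent of $x$. "Without reduction" means that no common factors are cancelled, so that for $a_n\ne\infty$ the numerators and denominators $A_n=A_n(x)$, $B_n=B_n(x)$ satisfy $A_n=a_nA_{n-1}+NA_{n-2}$ and $B_n=a_nB_{n-1}+NB_{n-2}$, with $A_{-1}=1$, $A_0=0$, $B_{-1}=0$, $B_0=1$. *)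

theory Defs
  imports "HOL-Analysis.Analysis"
begin

definition gauss_map :: "nat \<Rightarrow> real \<Rightarrow> real" where
  "gauss_map N x = (if x = 0 then 0 else frac (real N / x))"

text \<open>The coefficients \<open>a\<^sub>k\<close> are indexed by \<open>k \<ge> 1\<close>; the value at \<open>k = 0\<close> is irrelevant.\<close>

definition cf_coeff :: "nat \<Rightarrow> real \<Rightarrow> nat \<Rightarrow> enat" where
  "cf_coeff N x k =
     (let y = (gauss_map N ^^ (k - 1)) x
      in if y = 0 then \<infinity> else enat (nat \<lfloor>real N / y\<rfloor>))"

text \<open>Numerators and denominators of the unreduced convergents. The clauses for \<open>Suc 0\<close> are the
  general recursion with \<open>A\<^sub>-\<^sub>1 = 1\<close> and \<open>B\<^sub>-\<^sub>1 = 0\<close> inserted. As soon as a coefficient is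
  \<open>\<infinity>\<close>, so is \<open>B\<^sub>n\<close>.\<close>

fun cf_num :: "nat \<Rightarrow> real \<Rightarrow> nat \<Rightarrow> enat" where
  "cf_num N x 0 = 0"
| "cf_num N x (Suc 0) = cf_coeff N x 1 * 0 + enat N * 1"
| "cf_num N x (Suc (Suc n)) =
     cf_coeff N x (Suc (Suc n)) * cf_num N x (Suc n) + enat N * cf_num N x n"

fun cf_den :: "nat \<Rightarrow> real \<Rightarrow> nat \<Rightarrow> enat" where
  "cf_den N x 0 = 1"
| "cf_den N x (Suc 0) = cf_coeff N x 1 * 1 + enat N * 0"
| "cf_den N x (Suc (Suc n)) =
     cf_coeff N x (Suc (Suc n)) * cf_den N x (Suc n) + enat N * cf_den N x n"

text \<open>Extensions of the \<open>n\<close>-th root (used for \<open>n \<ge> 1\<close>) and of the logarithm by \<open>\<infinity> \<mapsto> \<infinity>\<close>.\<close>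

definition root_enat :: "nat \<Rightarrow> enat \<Rightarrow> ereal" where
  "root_enat n m = (case m of enat j \<Rightarrow> ereal (root n (real j)) | \<infinity> \<Rightarrow> \<infinity>)"

definition ln_enat :: "enat \<Rightarrow> ereal" where
  "ln_enat m = (case m of enat j \<Rightarrow> ereal (ln (real j)) | \<infinity> \<Rightarrow> \<infinity>)"

text \<open>The value \<open>N / (a\<^sub>1 + N / (a\<^sub>2 + \<dots> + N / a\<^sub>n))\<close> of a truncated continued fraction;
  \<open>cf_convergent\<close> below shows that it is \<open>A\<^sub>n / B\<^sub>n\<close> whenever the coefficients are finite.\<close>

definition cf_value :: "nat \<Rightarrow> real list \<Rightarrow> real" where
  "cf_value N as = foldr (\<lambda>a t. real N / (a + t)) as 0"

lemma gauss_map_range: "gauss_map N x \<in> {0..<1}"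
  by (simp add: gauss_map_def frac_lt_1)

lemma gauss_map_iter_range:
  assumes "x \<in> {0..<1}"
  shows "(gauss_map N ^^ k) x \<in> {0..<1}"
  using assms gauss_map_range by (cases k) auto

lemma cf_coeff_eq:
  assumes "x \<in> {0..<1}" "k \<ge> 1" "(gauss_map N ^^ (k - 1)) x \<noteq> 0"
  shows "real (the_enat (cf_coeff N x k)) =
    real N / (gauss_map N ^^ (k - 1)) x - (gauss_map N ^^ k) x"
proof -
  define y where "y = (gauss_map N ^^ (k - 1)) x"
  have y: "y > 0"
    using assms gauss_map_iter_range[OF assms(1), of "k - 1" N] unfolding y_def by auto
  have "(gauss_map N ^^ k) x = gauss_map N y"
    using assms(2) by (cases k) (auto simp: y_def)
  moreover have "\<lfloor>real N / y\<rfloor> \<ge> 0" using y by simp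
  ultimately show ?thesis
    using y unfolding cf_coeff_def y_def[symmetric] by (simp add: gauss_map_def frac_def)
qed

lemma cf_coeff_ge:
  assumes "x \<in> {0..<1}"
  shows "cf_coeff N x k \<ge> enat N"
proof -
  define y where "y = (gauss_map N ^^ (k - 1)) x"
  have y: "0 \<le> y" "y < 1"
    using gauss_map_iter_range[OF assms, of "k - 1" N] unfolding y_def by auto
  have "int N \<le> \<lfloor>real N / y\<rfloor>" if "y \<noteq> 0"
    using y that by (simp add: le_floor_iff field_simps mult_left_le_one_le)
  then show ?thesis
    unfolding cf_coeff_def y_def[symmetric] by (auto simp: le_nat_iff)
qed

lemma cf_convergent_finite:
  assumes "\<And>k. 1 \<le> k \<Longrightarrow> k \<le> n \<Longrightarrow> cf_coeff N x k \<noteq> \<infinity>"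
  shows "cf_num N x n \<noteq> \<infinity>" "cf_den N x n \<noteq> \<infinity>"
  using assms by (induction N x n rule: cf_num.induct) (auto simp: plus_eq_infty_iff_enat imult_is_infinity)

lemma cf_convergent_aux:
  assumes "x \<in> {0..<1}" "N > 0"
    and "\<And>k. 1 \<le> k \<Longrightarrow> k \<le> Suc n \<Longrightarrow> cf_coeff N x k \<noteq> \<infinity>" and "t \<ge> 0"
  defines "a \<equiv> \<lambda>k. real (the_enat (cf_coeff N x k))"
    and "A \<equiv> \<lambda>k. real (the_enat (cf_num N x k))"
    and "B \<equiv> \<lambda>k. real (the_enat (cf_den N x k))"
  shows "foldr (\<lambda>a t. real N / (a + t)) (map a [1..<Suc (Suc n)]) t =
           (A (Suc n) + t * A n) / (B (Suc n) + t * B n) \<and>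
         A (Suc n) > 0 \<and> B (Suc n) > 0 \<and> B n > 0"
  using assms(3,4)
proof (induction n arbitrary: t)
  case 0
  have "cf_coeff N x 1 \<ge> enat N" by (rule cf_coeff_ge[OF assms(1)])
  moreover obtain c where "cf_coeff N x 1 = enat c" using 0(1)[of 1] by auto
  ultimately show ?case
    using assms(2) by (simp add: a_def A_def B_def one_enat_def zero_enat_def)
next
  case (Suc n)
  let ?m = "Suc (Suc n)"
  have fin: "cf_num N x k \<noteq> \<infinity>" "cf_den N x k \<noteq> \<infinity>" if "k \<le> ?m" for k
    using cf_convergent_finite[of k N x] Suc.prems(1) that by auto
  have "cf_coeff N x ?m \<ge> enat N" by (rule cf_coeff_ge[OF assms(1)])
  moreover obtain c where c: "cf_coeff N x ?m = enat c" using Suc.prems(1)[of ?m] by auto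
  ultimately have a: "a ?m > 0" using assms(2) by (simp add: a_def)
  obtain p1 p0 q1 q0 where pq: "cf_num N x (Suc n) = enat p1" "cf_num N x n = enat p0"
      "cf_den N x (Suc n) = enat q1" "cf_den N x n = enat q0"
    using fin[of "Suc n"] fin[of n] by auto
  have rec: "A ?m = a ?m * A (Suc n) + real N * A n" "B ?m = a ?m * B (Suc n) + real N * B n"
    by (simp_all add: a_def A_def B_def pq c)
  have IH: "foldr (\<lambda>a t. real N / (a + t)) (map a [1..<?m]) s =
           (A (Suc n) + s * A n) / (B (Suc n) + s * B n) \<and>
         A (Suc n) > 0 \<and> B (Suc n) > 0 \<and> B n > 0" if "s \<ge> 0" for s
    using Suc.IH[of s] Suc.prems(1) that by simp
  define s where "s = real N / (a ?m + t)"
  have d: "a ?m + t > 0" using a Suc.prems(2) by simp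
  have s: "s \<ge> 0" using d by (simp add: s_def)
  have "foldr (\<lambda>a t. real N / (a + t)) (map a [1..<Suc ?m]) t =
      foldr (\<lambda>a t. real N / (a + t)) (map a [1..<?m]) s"
    by (simp add: s_def)
  also have "\<dots> = (A (Suc n) + s * A n) / (B (Suc n) + s * B n)"
    using IH[OF s] by simp
  also have "\<dots> = ((a ?m + t) * (A (Suc n) + s * A n)) / ((a ?m + t) * (B (Suc n) + s * B n))"
    using d by simp
  also have "(a ?m + t) * (A (Suc n) + s * A n) = A ?m + t * A (Suc n)"
    using d unfolding rec s_def by (simp add: field_simps)
  also have "(a ?m + t) * (B (Suc n) + s * B n) = B ?m + t * B (Suc n)"
    using d unfolding rec s_def by (simp add: field_simps)
  moreover have "A ?m > 0"
    using IH[OF s] a unfolding rec by (simp add: A_def add_pos_nonneg)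
  moreover have "B ?m > 0"
    using IH[OF s] a unfolding rec by (simp add: B_def add_pos_nonneg)
  ultimately show ?case using IH[OF s] by simp
qed

lemma cf_convergent:
  assumes "x \<in> {0..<1}" "N > 0" "n \<ge> 1"
    and "\<And>k. 1 \<le> k \<Longrightarrow> k \<le> n \<Longrightarrow> cf_coeff N x k \<noteq> \<infinity>"
  shows "cf_value N (map (\<lambda>k. real (the_enat (cf_coeff N x k))) [1..<Suc n]) =
           real (the_enat (cf_num N x n)) / real (the_enat (cf_den N x n))"
    and "the_enat (cf_num N x n) > 0" and "the_enat (cf_den N x n) > 0"
  using cf_convergent_aux[of x N "n - 1" 0] assms unfolding cf_value_def by simp_all

end

theory Submission
  imports Defs "HOL-Library.Discrete_Functions" "HOL-Real_Asymp.Real_Asymp"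
begin

text \<open>
  Write \<open>T\<close> for the map \<open>x \<mapsto> {N/x}\<close>. The orbit of a typical point determines both quantities through
  Birkhoff sums: \<open>ln (a\<^sub>1 \<cdots> a\<^sub>n)\<close> is the sum of \<open>f (T\<^sup>k x)\<close> over \<open>k < n\<close> for
  \<open>f x = ln \<lfloor>N/x\<rfloor>\<close>, and \<open>ln B\<^sub>n\<close> is, up to an error of at most \<open>ln 2\<close>, the same sum for
  \<open>f x = ln (N/x)\<close>, because \<open>B\<^sub>n\<^sub>+\<^sub>1 + T\<^sup>n\<^sup>+\<^sup>1 x \<cdot> B\<^sub>n\<close> is the product of the numbers \<open>N / T\<^sup>k x\<close>, \<open>k \<le> n\<close>.

  The almost sure convergence of these averages is obtained without the general ergodic theorem. The measure
  \<open>\<mu>\<close> with density \<open>1/(N+x)\<close> on \<open>(0,1]\<close> is \<open>T\<close>-invariant, and composition with \<open>T\<close> has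
  in \<open>L\<^sup>2(\<mu>)\<close> the explicit adjoint \<open>U f s = (\<Sum>j. w\<^sub>j(s) f (N/(N+j+s)))\<close> with positive weights of sum 1
  (\<open>nn_integral_transfer\<close>, \<open>integral_mult_gauss_map\<close>). Hence \<open>D = f - U f \<circ> T\<close> is orthogonal to
  every square integrable function of \<open>T x\<close>, so that the functions \<open>D \<circ> T\<^sup>k\<close> are pairwise orthogonal with
  equal norms, and a law of large numbers for orthogonal variables (\<open>orthogonal_strong_law\<close>)
  shows that \<open>f\<close> and \<open>U f\<close> have asymptotically equal averages along almost every orbit.
  Repeating this, \<open>f\<close> may be replaced by \<open>U\<^sup>m f\<close> for every \<open>m\<close>. Now \<open>U\<close> shrinks Lipschitz constants
  on \<open>[0,1]\<close> by the factor \<open>7/8\<close> (\<open>transfer_contracts_lipschitz\<close>) and \<open>U f\<close> is Lipschitz for the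
  two logarithms above, so \<open>U\<^sup>m f\<close> tends uniformly to a constant \<open>c\<close>, which must be the limit of the averages
  (\<open>AE_ergodic_average\<close>).

  Since \<open>U\<close> averages, \<open>c\<close> lies between any lower and upper bound of \<open>U f\<close>. Summation by parts
  evaluates \<open>U f\<close> for the logarithms as \<open>ln N + 1 + O(1/N)\<close> (\<open>log_transfer_bounds\<close>), which gives both limits
  for \<open>N \<longlongrightarrow> \<infinity>\<close> without a formula for the constants. The bound for every \<open>x\<close> is elementary: all coefficients are
  at least \<open>N\<close>, so \<open>B\<^sub>n\<close> dominates the solution of \<open>b\<^sub>n\<^sub>+\<^sub>2 = N b\<^sub>n\<^sub>+\<^sub>1 + N b\<^sub>n\<close>, which grows like the
  powers of the positive root of \<open>r\<^sup>2 = N r + N\<close>.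
\<close>

section \<open>The transfer operator of the map\<close>

text \<open>
  The inverse branches of the map, numbered so that branch \<open>j\<close> belongs to the coefficient \<open>N + j\<close>.
\<close>

definition branch :: "nat \<Rightarrow> real \<Rightarrow> nat \<Rightarrow> real" where
  "branch N s j = real N / (real N + real j + s)"

text \<open>
  These weights are the push-forward of the invariant density \<open>1/(N+s)\<close>: branch \<open>j\<close> carries
  \<open>h(u\<^sub>j(s)) \<bar>u\<^sub>j'(s)\<bar> / h(s)\<close> with \<open>h(s) = 1/(N+s)\<close> and \<open>u\<^sub>j(s) = N/(N+j+s)\<close>.
\<close>

definition weight :: "nat \<Rightarrow> real \<Rightarrow> nat \<Rightarrow> real" where
  "weight N s j = (real N + s) / ((real N + real j + s) * (real N + real j + 1 + s))"

definition gauss_transfer :: "nat \<Rightarrow> (real \<Rightarrow> real) \<Rightarrow> real \<Rightarrow> real" where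
  "gauss_transfer N f s = (\<Sum>j. weight N s j * f (branch N s j))"

text \<open>
  The sum of the weights from index \<open>j\<close> on. Sums against the weights are evaluated by parts
  through these tails, since the tails depend on \<open>s\<close> in a simpler way than the weights.
\<close>

definition weight_tail :: "nat \<Rightarrow> real \<Rightarrow> nat \<Rightarrow> real" where
  "weight_tail N s j = (real N + s) / (real N + real j + s)"

lemma branch_bounds:
  assumes "N > 0" "0 \<le> s"
  shows "0 < branch N s j" "branch N s j \<le> 1"
  using assms by (auto simp: branch_def field_simps)

lemma weight_eq_weight_tail_diff:
  assumes "N > 0" "0 \<le> s"
  shows "weight N s j = weight_tail N s j - weight_tail N s (Suc j)"
proof -
  have "real N + s > 0" "real N + real j + s > 0" "real N + real j + 1 + s > 0" using assms by auto
  then show ?thesis unfolding weight_def weight_tail_def by (simp add: divide_simps) (simp add: algebra_simps)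
qed

lemma weight_tail_0: "N > 0 \<Longrightarrow> 0 \<le> s \<Longrightarrow> weight_tail N s 0 = 1"
  by (simp add: weight_tail_def)

lemma weight_nonneg: "0 \<le> s \<Longrightarrow> 0 \<le> weight N s j"
  by (simp add: weight_def)

lemma tendsto_weight_tail: "weight_tail N s \<longlonglongrightarrow> 0"
proof -
  have "(\<lambda>j::nat. (real N + s) / (real N + real j + s)) \<longlonglongrightarrow> 0"
    by real_asymp
  then show ?thesis unfolding weight_tail_def[abs_def] .
qed

lemma weight_sums: "N > 0 \<Longrightarrow> 0 \<le> s \<Longrightarrow> weight N s sums 1"
  using telescope_sums'[OF tendsto_weight_tail[of N s]] weight_eq_weight_tail_diff[of N s, symmetric] weight_tail_0[of N s]
  by simp

lemma weight_Suc_sums: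
  assumes "N > 0" "0 \<le> s"
  shows "(\<lambda>j. weight N s (Suc j)) sums ((real N + s) / (real N + s + 1))"
proof -
  have "(\<lambda>j. weight N s (Suc j)) sums (1 - weight N s 0)"
    using sums_split_initial_segment[OF weight_sums[OF assms], of 1] by simp
  moreover have "1 - weight N s 0 = (real N + s) / (real N + s + 1)"
  proof -
    have "real N + s > 0" "real N + s + 1 > 0" using assms by auto
    then have "1 - (real N + s) / ((real N + s) * (real N + s + 1)) = (real N + s) / (real N + s + 1)"
      by (simp add: divide_simps)
    then show ?thesis by (simp add: weight_def add_ac)
  qed
  ultimately show ?thesis by simp
qed

lemma sums_by_parts:
  fixes G v :: "nat \<Rightarrow> real"
  assumes "(\<lambda>n. G n * v n) \<longlonglongrightarrow> 0"
    and "(\<lambda>j. G (Suc j) * (v (Suc j) - v j)) sums S"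
  shows "(\<lambda>j. (G j - G (Suc j)) * v j) sums (G 0 * v 0 + S)"
proof -
  have "(\<Sum>j<n. (G j - G (Suc j)) * v j) =
      G 0 * v 0 - G n * v n + (\<Sum>j<n. G (Suc j) * (v (Suc j) - v j))" for n
    by (induction n) (auto simp: algebra_simps)
  moreover have "(\<lambda>n. G 0 * v 0 - G n * v n + (\<Sum>j<n. G (Suc j) * (v (Suc j) - v j)))
      \<longlonglongrightarrow> G 0 * v 0 - 0 + S"
    using assms unfolding sums_def by (intro tendsto_intros)
  ultimately show ?thesis unfolding sums_def by simp
qed

lemma weight_tail_diff:
  assumes "N > 0" "0 \<le> s" "0 \<le> t"
  shows "weight_tail N s j - weight_tail N t j = real j * (s - t) / ((real N + real j + s) * (real N + real j + t))"
proof -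
  have "real N + real j + s > 0" "real N + real j + t > 0" using assms by auto
  then show ?thesis unfolding weight_tail_def by (simp add: divide_simps) (simp add: algebra_simps)
qed

text \<open>
  The first bound is uniform in \<open>j\<close> and comes from \<open>4 N j \<le> (N + j)\<^sup>2\<close>; it makes the contraction
  constant small enough. The second one decays in \<open>j\<close> and makes the series converge for
  logarithms, whose increments are only of order \<open>1/j\<close>.
\<close>

lemma abs_weight_tail_diff_le:
  assumes "N > 0" "0 \<le> s" "0 \<le> t"
  shows "\<bar>weight_tail N s j - weight_tail N t j\<bar> \<le> \<bar>s - t\<bar> / (4 * real N)"
    and "\<bar>weight_tail N s j - weight_tail N t j\<bar> \<le> \<bar>s - t\<bar> / (real N + real j)"
proof -
  define n where "n = real N + real j"
  have n: "n > 0" "real j \<le> n" using assms by (auto simp: n_def)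
  have eq: "\<bar>weight_tail N s j - weight_tail N t j\<bar> = real j * \<bar>s - t\<bar> / ((n + s) * (n + t))"
    using assms n by (simp add: weight_tail_diff n_def[symmetric] abs_mult)
  have "\<bar>weight_tail N s j - weight_tail N t j\<bar> \<le> real j * \<bar>s - t\<bar> / (n * n)"
    unfolding eq using assms n by (intro divide_left_mono mult_mono mult_pos_pos) auto
  also have "\<dots> = \<bar>s - t\<bar> * (real j / n\<^sup>2)" by (simp add: power2_eq_square)
  finally have le: "\<bar>weight_tail N s j - weight_tail N t j\<bar> \<le> \<bar>s - t\<bar> * (real j / n\<^sup>2)" .
  have "real j / n\<^sup>2 \<le> 1 / n" using n by (simp add: power2_eq_square divide_simps)
  from order.trans[OF le mult_left_mono[OF this]] 
  show "\<bar>weight_tail N s j - weight_tail N t j\<bar> \<le> \<bar>s - t\<bar> / (real N + real j)" by (simp add: n_def)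
  have "0 \<le> (real N - real j)\<^sup>2" by simp
  then have "4 * real N * real j \<le> n\<^sup>2" unfolding n_def by (simp add: power2_eq_square algebra_simps)
  then have "real j / n\<^sup>2 \<le> 1 / (4 * real N)" using n assms by (simp add: divide_simps mult.commute)
  from order.trans[OF le mult_left_mono[OF this]] 
  show "\<bar>weight_tail N s j - weight_tail N t j\<bar> \<le> \<bar>s - t\<bar> / (4 * real N)" by simp
qed

text \<open>
  Two effects change \<open>U f\<close> when \<open>s\<close> moves to \<open>t\<close>: the values \<open>p\<close> on the branches become
  \<open>q\<close>, at total cost \<open>A\<close>, and the weights change. As the weights keep total mass 1, the second effect
  only sees the increments of \<open>q\<close>, which summation by parts brings out; its cost is \<open>B\<close>.
\<close>

lemma weighted_sum_diff_le:
  assumes N: "N > 0" and s: "0 \<le> s" and t: "0 \<le> t"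
    and summ: "summable (\<lambda>j. weight N s j * p j)" "summable (\<lambda>j. weight N t j * q j)"
    and vert: "\<And>j. \<bar>p j - q j\<bar> \<le> a j" "(\<lambda>j. weight N s j * a j) sums A"
    and hor: "\<And>j. \<bar>(weight_tail N s (Suc j) - weight_tail N t (Suc j)) * (q (Suc j) - q j)\<bar> \<le> b j" "b sums B"
    and lim: "(\<lambda>j. (weight_tail N s j - weight_tail N t j) * q j) \<longlonglongrightarrow> 0"
  shows "\<bar>(\<Sum>j. weight N s j * p j) - (\<Sum>j. weight N t j * q j)\<bar> \<le> A + B"
proof -
  define d where "d j = weight_tail N s j - weight_tail N t j" for j
  have "summable (\<lambda>j. d (Suc j) * (q (Suc j) - q j))"
    using hor by (intro summable_comparison_test[OF _ sums_summable[OF hor(2)]]) (auto simp: d_def)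
  then obtain S where S: "(\<lambda>j. d (Suc j) * (q (Suc j) - q j)) sums S"
    by (auto simp: summable_def)
  have "norm S \<le> B"
    using S hor by (intro norm_sums_le[OF S hor(2)]) (auto simp: d_def)
  have parts: "(\<lambda>j. (d j - d (Suc j)) * q j) sums S"
    using sums_by_parts[OF lim[folded d_def] S] by (simp add: d_def weight_tail_0 N s t)
  have "summable (\<lambda>j. weight N s j * (p j - q j))"
    using vert by (intro summable_comparison_test[OF _ sums_summable[OF vert(2)]])
      (auto simp: abs_mult weight_nonneg s intro!: mult_left_mono)
  then obtain R where R: "(\<lambda>j. weight N s j * (p j - q j)) sums R"
    by (auto simp: summable_def)
  have "norm R \<le> A"
    using vert by (intro norm_sums_le[OF R vert(2)]) (auto simp: abs_mult weight_nonneg s intro!: mult_left_mono)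
  have "(\<lambda>j. weight N s j * p j - weight N t j * q j) sums
      ((\<Sum>j. weight N s j * p j) - (\<Sum>j. weight N t j * q j))"
    using summ by (intro sums_diff summable_sums)
  moreover have "(\<lambda>j. weight N s j * p j - weight N t j * q j) =
      (\<lambda>j. weight N s j * (p j - q j) + (d j - d (Suc j)) * q j)"
    by (simp add: weight_eq_weight_tail_diff N s t d_def fun_eq_iff algebra_simps)
  ultimately have "(\<Sum>j. weight N s j * p j) - (\<Sum>j. weight N t j * q j) = R + S"
    using sums_unique2 sums_add[OF R parts] by metis
  then show ?thesis using \<open>norm R \<le> A\<close> \<open>norm S \<le> B\<close> by auto
qed

lemma transfer_summable_bounded:
  assumes "N > 0" "0 \<le> s" "\<And>x. 0 < x \<Longrightarrow> x \<le> 1 \<Longrightarrow> \<bar>f x\<bar> \<le> C"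
  shows "summable (\<lambda>j. weight N s j * f (branch N s j))"
proof (rule summable_comparison_test)
  show "summable (\<lambda>j. weight N s j * C)"
    using weight_sums[OF assms(1,2)] by (intro summable_mult2) (auto simp: summable_def)
  show "\<exists>M. \<forall>n\<ge>M. norm (weight N s n * f (branch N s n)) \<le> weight N s n * C"
    using assms branch_bounds[OF assms(1,2)]
    by (auto simp: abs_mult weight_nonneg intro!: mult_left_mono)
qed

lemma transfer_bounds:
  assumes "N > 0" "0 \<le> s" "\<And>x. 0 < x \<Longrightarrow> x \<le> 1 \<Longrightarrow> lo \<le> f x \<and> f x \<le> hi"
  shows "lo \<le> gauss_transfer N f s" "gauss_transfer N f s \<le> hi"
proof -
  have s: "summable (\<lambda>j. weight N s j * f (branch N s j))"
    using assms(3) by (intro transfer_summable_bounded[where C="max \<bar>lo\<bar> \<bar>hi\<bar>"] assms) fastforce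
  have f: "lo \<le> f (branch N s j)" "f (branch N s j) \<le> hi" for j
    using assms(3) branch_bounds[OF assms(1,2)] by auto
  have "(\<lambda>j. weight N s j * c) sums c" for c
    using sums_mult2[OF weight_sums[OF assms(1,2)], of c] by simp
  note 1 = this
  show "lo \<le> gauss_transfer N f s" unfolding gauss_transfer_def
    using f by (intro sums_le[OF _ 1 summable_sums[OF s]] mult_left_mono weight_nonneg assms)
  show "gauss_transfer N f s \<le> hi" unfolding gauss_transfer_def
    using f by (intro sums_le[OF _ summable_sums[OF s] 1] mult_left_mono weight_nonneg assms)
qed

text \<open>
  The values of interest are \<open>n = N\<close> and \<open>y = N + s\<close>. The left hand side tends to 0 for large \<open>N\<close>; the case
  \<open>N = 1\<close> is critical and has to be treated apart.
\<close>

lemma contraction_constant: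
  fixes y n :: real
  assumes "n = 1 \<or> n \<ge> 2" "n \<le> y"
  shows "n / ((y + 1) * (n + 1)) * (y / (y + 1)) + 1 / (y * (y + 1)) \<le> 5 / 8"
proof -
  have y: "y \<ge> 1" using assms by auto
  have q: "y / (y + 1)\<^sup>2 \<le> 1 / 4"
    using y sum_squares_ge_zero[of "y - 1" 0] by (simp add: divide_simps power2_eq_square algebra_simps)
  have eq: "n / ((y + 1) * (n + 1)) * (y / (y + 1)) = n / (n + 1) * (y / (y + 1)\<^sup>2)"
    by (simp add: power2_eq_square)
  have yy: "m * (m + 1) \<le> y * (y + 1)" if "0 \<le> m" "m \<le> y" for m
    using that by (intro mult_mono) auto
  show ?thesis
  proof (cases "n = 1")
    case True
    have "1 / (y * (y + 1)) \<le> 1 / 2" using yy[of 1] y by (simp add: divide_simps)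
    moreover have "n / (n + 1) * (y / (y + 1)\<^sup>2) \<le> 1 / 2 * (1 / 4)"
      using q True y by (intro mult_mono) auto
    ultimately show ?thesis unfolding eq by simp
  next
    case False
    then have "y \<ge> 2" "n \<ge> 2" using assms by auto
    have "1 / (y * (y + 1)) \<le> 1 / 6" using yy[of 2] \<open>y \<ge> 2\<close> by (simp add: divide_simps)
    moreover have "n / (n + 1) * (y / (y + 1)\<^sup>2) \<le> 1 * (1/4)"
      using \<open>n \<ge> 2\<close> q y by (intro mult_mono) (auto simp: divide_simps)
    ultimately show ?thesis unfolding eq by simp
  qed
qed

text \<open>
  The change of the branch values costs at most \<open>5/8\<close> and the change of the weights at most \<open>1/4\<close> of
  \<open>L \<bar>s - t\<bar>\<close>. In the first part branch 0 must be separated from the others: it is the least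
  contracting one, and for \<open>N = 1\<close> its derivative has absolute value 1 at \<open>s = 0\<close>.
\<close>

lemma transfer_contracts_lipschitz:
  assumes N: "N > 0" and L: "L \<ge> 0"
    and lip: "\<And>x y. x \<in> {0..1} \<Longrightarrow> y \<in> {0..1} \<Longrightarrow> \<bar>f x - f y\<bar> \<le> L * \<bar>x - y\<bar>"
    and st: "s \<in> {0..1}" "t \<in> {0..1}"
  shows "\<bar>gauss_transfer N f s - gauss_transfer N f t\<bar> \<le> 7 / 8 * L * \<bar>s - t\<bar>"
proof -
  have s: "0 \<le> s" and t: "0 \<le> t" using st by auto
  define y where "y = real N + s"
  define y' where "y' = real N + t"
  have pos: "real N \<ge> 1" "y \<ge> 1" "y' \<ge> 1" "real N \<le> y" "real N \<le> y'"
    using N s t by (auto simp: y_def y'_def)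
  \<comment> \<open>\<open>k1\<close> bounds the displacement of the values on branch 0, \<open>k2\<close> on all other branches.\<close>
  define k1 where "k1 = L * \<bar>s - t\<bar> * (1 / y)"
  define k2 where "k2 = L * \<bar>s - t\<bar> * (real N / ((y + 1) * (real N + 1)))"
  define a where "a j = (if j = 0 then k1 else k2)" for j :: nat
  have bd: "\<bar>f x\<bar> \<le> \<bar>f 0\<bar> + L" if "0 \<le> x" "x \<le> 1" for x
  proof -
    have "\<bar>f x - f 0\<bar> \<le> L * \<bar>x - 0\<bar>" using that by (intro lip) auto
    also have "\<dots> \<le> L * 1" using that L by (intro mult_left_mono) auto
    finally show ?thesis by linarith
  qed
  have lipb: "\<bar>f (branch N u i) - f (branch N v j)\<bar> \<le> L * \<bar>branch N u i - branch N v j\<bar>"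
    if "0 \<le> u" "0 \<le> v" for u v i j
    using branch_bounds[OF N that(1), of i] branch_bounds[OF N that(2), of j] by (intro lip) auto
  have bdiff: "\<bar>branch N s j - branch N t j\<bar> = \<bar>s - t\<bar> * (real N / ((y + j) * (y' + j)))" for j
  proof -
    have "y + j > 0" "y' + j > 0" using pos by auto
    then have "branch N s j - branch N t j = (t - s) * (real N / ((y + j) * (y' + j)))"
      unfolding branch_def y_def y'_def by (simp add: divide_simps add_ac) (simp add: algebra_simps)
    then show ?thesis using \<open>y + j > 0\<close> \<open>y' + j > 0\<close> by (simp add: abs_mult abs_minus_commute)
  qed
  have "\<bar>gauss_transfer N f s - gauss_transfer N f t\<bar> \<le> (k2 + weight N s 0 * (k1 - k2)) + L * \<bar>s - t\<bar> / 4"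
    unfolding gauss_transfer_def
  proof (rule weighted_sum_diff_le[OF N s t, where a=a and b="\<lambda>j. L * \<bar>s - t\<bar> / 4 * weight N t j"])
    show "summable (\<lambda>j. weight N s j * f (branch N s j))"
      "summable (\<lambda>j. weight N t j * f (branch N t j))"
      using bd by (auto intro!: transfer_summable_bounded[where C="\<bar>f 0\<bar> + L"] N s t)
    show "\<bar>f (branch N s j) - f (branch N t j)\<bar> \<le> a j" for j
    proof -
      have "\<bar>f (branch N s j) - f (branch N t j)\<bar> \<le> L * \<bar>s - t\<bar> * (real N / ((y + j) * (y' + j)))"
        using lipb[OF s t, of j j] by (simp add: bdiff mult.assoc)
      also have "\<dots> \<le> a j"
      proof (cases "j = 0")
        case True
        have "real N / (y * y') \<le> 1 / y" using pos by (simp add: divide_simps)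
        then show ?thesis using True L by (simp add: a_def k1_def mult_left_mono del: times_divide_eq_right)
      next
        case False
        have "real N / ((y + j) * (y' + j)) \<le> real N / ((y + 1) * (real N + 1))"
          using pos False by (intro divide_left_mono mult_mono mult_pos_pos) auto
        then show ?thesis using False L by (simp add: a_def k2_def mult_left_mono del: times_divide_eq_right)
      qed
      finally show ?thesis .
    qed
    have "(\<lambda>j. weight N s j * k2 + (if j = 0 then weight N s j * (k1 - k2) else 0)) sums
        (1 * k2 + weight N s 0 * (k1 - k2))"
      by (intro sums_add sums_mult2 weight_sums N s sums_single)
    moreover have "(\<lambda>j. weight N s j * k2 + (if j = 0 then weight N s j * (k1 - k2) else 0)) =
        (\<lambda>j. weight N s j * a j)"
      by (auto simp: a_def algebra_simps)
    ultimately show "(\<lambda>j. weight N s j * a j) sums (k2 + weight N s 0 * (k1 - k2))" by simp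
    show "\<bar>(weight_tail N s (Suc j) - weight_tail N t (Suc j)) * (f (branch N t (Suc j)) - f (branch N t j))\<bar>
      \<le> L * \<bar>s - t\<bar> / 4 * weight N t j" for j
    proof -
      have p: "y' + j > 0" "y' + j + 1 > 0" using pos by auto
      then have "branch N t j - branch N t (Suc j) = real N / ((y' + j) * (y' + j + 1))"
        unfolding branch_def y'_def by (simp add: divide_simps add_ac) (simp add: algebra_simps)
      then have "\<bar>branch N t (Suc j) - branch N t j\<bar> = real N / ((y' + j) * (y' + j + 1))"
        using p by (metis abs_minus_commute abs_of_nonneg divide_nonneg_pos mult_pos_pos of_nat_0_le_iff)
      then have "\<bar>f (branch N t (Suc j)) - f (branch N t j)\<bar> \<le> L * (real N / ((y' + j) * (y' + j + 1)))"
        using lipb[OF t t, of "Suc j" j] by simp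
      then have "\<bar>(weight_tail N s (Suc j) - weight_tail N t (Suc j)) * (f (branch N t (Suc j)) - f (branch N t j))\<bar>
        \<le> \<bar>s - t\<bar> / (4 * real N) * (L * (real N / ((y' + j) * (y' + j + 1))))"
        unfolding abs_mult using N s t by (intro mult_mono abs_weight_tail_diff_le) auto
      also have "\<dots> = L * \<bar>s - t\<bar> / 4 * (1 / ((y' + j) * (y' + j + 1)))"
        using pos by simp
      also have "\<dots> \<le> L * \<bar>s - t\<bar> / 4 * weight N t j"
      proof (intro mult_left_mono)
        have "weight N t j = y' / ((y' + j) * (y' + j + 1))"
          by (simp add: weight_def y'_def add_ac)
        then show "1 / ((y' + j) * (y' + j + 1)) \<le> weight N t j"
          using pos p by (auto intro!: divide_right_mono)
      qed (use L in auto)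
      finally show ?thesis .
    qed
    show "(\<lambda>j. L * \<bar>s - t\<bar> / 4 * weight N t j) sums (L * \<bar>s - t\<bar> / 4)"
      using sums_mult[OF weight_sums[OF N t], of "L * \<bar>s - t\<bar> / 4"] by simp
    have "(\<lambda>j. weight_tail N s j - weight_tail N t j) \<longlonglongrightarrow> 0"
      using tendsto_diff[OF tendsto_weight_tail tendsto_weight_tail, of N s N t] by simp
    then have "(\<lambda>j. \<bar>weight_tail N s j - weight_tail N t j\<bar> * (\<bar>f 0\<bar> + L)) \<longlonglongrightarrow> 0"
      by (intro tendsto_mult_left_zero tendsto_rabs_zero)
    then show "(\<lambda>j. (weight_tail N s j - weight_tail N t j) * f (branch N t j)) \<longlonglongrightarrow> 0"
      by (rule Lim_null_comparison[rotated])
        (auto simp: abs_mult intro!: always_eventually mult_left_mono bd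
          less_imp_le[OF branch_bounds(1)[OF N t]] branch_bounds[OF N t])
  qed
  also have "k2 + weight N s 0 * (k1 - k2) = k2 * (y / (y + 1)) + weight N s 0 * k1"
  proof -
    have "y / (y + 1) = 1 - weight N s 0"
      using pos by (simp add: weight_def y_def[symmetric] divide_simps) (simp add: y_def algebra_simps)
    then show ?thesis by (simp only:) (simp add: algebra_simps)
  qed
  also have "weight N s 0 = 1 / (y + 1)"
    using pos by (simp add: weight_def y_def add_ac)
  also have "k2 * (y / (y + 1)) + 1 / (y + 1) * k1 = L * \<bar>s - t\<bar> *
      (real N / ((y + 1) * (real N + 1)) * (y / (y + 1)) + 1 / (y * (y + 1)))"
    by (simp add: k1_def k2_def algebra_simps)
  also have "\<dots> \<le> L * \<bar>s - t\<bar> * (5 / 8)"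
    using N pos L by (intro mult_left_mono contraction_constant) auto
  finally show ?thesis by (simp add: algebra_simps)
qed

section \<open>A strong law for orthogonal random variables\<close>

text \<open>
  By monotone convergence the series of the \<open>Y m\<close> has finite integral, so it converges almost everywhere.
\<close>

lemma AE_tendsto_0_if_summable_integrals:
  fixes Y :: "nat \<Rightarrow> 'a \<Rightarrow> real"
  assumes int: "\<And>m. integrable M (Y m)" and nonneg: "\<And>m x. 0 \<le> Y m x"
    and le: "\<And>m. (\<integral>x. Y m x \<partial>M) \<le> b m" and b: "summable b"
  shows "AE x in M. (\<lambda>m. Y m x) \<longlonglongrightarrow> 0"
proof -
  have [measurable]: "Y m \<in> borel_measurable M" for m using int by auto
  have b0: "0 \<le> b m" for m
    by (rule order.trans[OF integral_nonneg_AE le]) (simp add: nonneg)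
  have "(\<integral>\<^sup>+x. (\<Sum>m. ennreal (Y m x)) \<partial>M) = (\<Sum>m. \<integral>\<^sup>+x. ennreal (Y m x) \<partial>M)"
    by (intro nn_integral_suminf) simp
  also have "\<dots> \<le> (\<Sum>m. ennreal (b m))"
    using int nonneg le by (intro suminf_le) (auto simp: nn_integral_eq_integral ennreal_leI)
  also have "\<dots> = ennreal (\<Sum>m. b m)" using b0 b by (intro suminf_ennreal2) auto
  finally have "(\<integral>\<^sup>+x. (\<Sum>m. ennreal (Y m x)) \<partial>M) \<noteq> \<infinity>"
    by (auto simp: top_unique)
  then have "AE x in M. (\<Sum>m. ennreal (Y m x)) \<noteq> \<infinity>"
    by (intro nn_integral_PInf_AE) simp_all
  then show ?thesis
  proof eventually_elim
    case (elim x)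
    then have "summable (\<lambda>m. Y m x)"
      using nonneg by (intro summable_suminf_not_top) auto
    then show ?case by (rule summable_LIMSEQ_zero)
  qed
qed

lemma abs_mult_le_squares: "\<bar>a * b\<bar> \<le> a\<^sup>2 + b\<^sup>2" for a b :: real
proof -
  have "2 * (\<bar>a\<bar> * \<bar>b\<bar>) \<le> \<bar>a\<bar>\<^sup>2 + \<bar>b\<bar>\<^sup>2"
    using sum_squares_bound[of "\<bar>a\<bar>" "\<bar>b\<bar>"] by simp
  moreover have "0 \<le> \<bar>a\<bar> * \<bar>b\<bar>" by simp
  ultimately show ?thesis unfolding abs_mult power2_abs by linarith
qed

text \<open>
  Orthogonality bounds the second moment of the \<open>n\<close>-th partial sum \<open>S\<^sub>n\<close> by \<open>n C\<close>, so
  \<open>(S\<^sub>n / n)\<^sup>2\<close> has summable integrals along \<open>n = m\<^sup>2\<close>. Between two squares there are only \<open>2 m + 1\<close> terms,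
  and by the Cauchy-Schwarz inequality the square of any partial sum over such a block is at most
  \<open>2 m + 1\<close> times the sum of squares over the whole block, whose integral divided by \<open>m\<^sup>4\<close> is again summable.
\<close>

lemma orthogonal_strong_law:
  fixes X :: "nat \<Rightarrow> 'a \<Rightarrow> real"
  assumes meas [measurable]: "\<And>i. X i \<in> borel_measurable M"
    and sq: "\<And>i. integrable M (\<lambda>x. (X i x)\<^sup>2)"
    and C: "\<And>i. (\<integral>x. (X i x)\<^sup>2 \<partial>M) \<le> C"
    and orth: "\<And>i j. i < j \<Longrightarrow> (\<integral>x. X i x * X j x \<partial>M) = 0"
  shows "AE x in M. (\<lambda>n. (\<Sum>i<n. X i x) / real n) \<longlonglongrightarrow> 0"
proof -
  have C0: "0 \<le> C" by (rule order.trans[OF integral_nonneg_AE C[of 0]]) simp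
  have prod: "integrable M (\<lambda>x. X i x * X j x)" for i j
  proof (rule Bochner_Integration.integrable_bound)
    show "integrable M (\<lambda>x. (X i x)\<^sup>2 + (X j x)\<^sup>2)" using sq by simp
    show "AE x in M. norm (X i x * X j x) \<le> norm ((X i x)\<^sup>2 + (X j x)\<^sup>2)"
      by (simp add: abs_mult_le_squares)
  qed simp
  have orth': "(\<integral>x. X i x * X j x \<partial>M) = (if i = j then (\<integral>x. (X i x)\<^sup>2 \<partial>M) else 0)" for i j
    using orth[of i j] orth[of j i] by (cases i j rule: linorder_cases)
      (auto simp: power2_eq_square mult.commute)
  define S where "S n x = (\<Sum>i<n. X i x)" for n x
  have Ssq: "(S n x)\<^sup>2 = (\<Sum>i<n. \<Sum>j<n. X i x * X j x)" for n x
    by (simp add: S_def power2_eq_square sum_product)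
  have Sint: "integrable M (\<lambda>x. (S n x)\<^sup>2)" for n
    unfolding Ssq using prod by simp
  have Sbound: "(\<integral>x. (S n x)\<^sup>2 \<partial>M) \<le> real n * C" for n
  proof -
    have "(\<integral>x. (S n x)\<^sup>2 \<partial>M) = (\<Sum>i<n. \<Sum>j<n. \<integral>x. X i x * X j x \<partial>M)"
      unfolding Ssq using prod by (simp add: Bochner_Integration.integral_sum)
    also have "\<dots> = (\<Sum>i<n. \<integral>x. (X i x)\<^sup>2 \<partial>M)" by (simp add: orth')
    also have "\<dots> \<le> (\<Sum>i<n. C)" using C by (intro sum_mono)
    finally show ?thesis by simp
  qed
  define B where "B m = {m\<^sup>2..<(Suc m)\<^sup>2}" for m :: nat
  have cardB: "card (B m) = 2 * m + 1" for m by (simp add: B_def power2_eq_square)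
  \<comment> \<open>dominates, for all \<open>n\<close> in block \<open>m\<close> at once, both contributions to \<open>(S\<^sub>n / n)\<^sup>2\<close>\<close>
  define Y where "Y m x = ((S (m\<^sup>2) x)\<^sup>2 + (2 * real m + 1) * (\<Sum>i\<in>B m. (X i x)\<^sup>2)) / real m ^ 4" for m x
  have "AE x in M. (\<lambda>m. Y m x) \<longlonglongrightarrow> 0"
  proof (rule AE_tendsto_0_if_summable_integrals)
    show "integrable M (Y m)" for m
      unfolding Y_def using Sint sq by simp
    show "0 \<le> Y m x" for m x unfolding Y_def by (intro divide_nonneg_nonneg add_nonneg_nonneg mult_nonneg_nonneg sum_nonneg) auto
    show "(\<integral>x. Y m x \<partial>M) \<le> 10 * C * (1 / real m ^ 2)" for m
    proof (cases "m = 0")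
      case False
      have "(\<integral>x. Y m x \<partial>M) = ((\<integral>x. (S (m\<^sup>2) x)\<^sup>2 \<partial>M) +
          (2 * real m + 1) * (\<Sum>i\<in>B m. \<integral>x. (X i x)\<^sup>2 \<partial>M)) / real m ^ 4"
        unfolding Y_def using Sint sq by (simp add: Bochner_Integration.integral_sum)
      also have "\<dots> \<le> (real (m\<^sup>2) * C + (2 * real m + 1) * (\<Sum>i\<in>B m. C)) / real m ^ 4"
        using Sbound[of "m\<^sup>2"] C by (intro divide_right_mono add_mono mult_left_mono sum_mono) auto
      also have "\<dots> = C * ((real m)\<^sup>2 + (2 * real m + 1)\<^sup>2) / real m ^ 4"
        by (simp add: cardB power2_eq_square algebra_simps)
      also have "\<dots> \<le> C * (10 * (real m)\<^sup>2) / real m ^ 4"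
      proof -
        have "(2 * real m + 1)\<^sup>2 \<le> (3 * real m)\<^sup>2" using False by (intro power_mono) auto
        then show ?thesis using C0 by (intro divide_right_mono mult_left_mono) (auto simp: power_mult_distrib)
      qed
      also have "\<dots> = 10 * C * (1 / real m ^ 2)"
        using False by (simp add: power2_eq_square power4_eq_xxxx)
      finally show ?thesis .
    qed (simp add: Y_def)
    show "summable (\<lambda>m. 10 * C * (1 / real m ^ 2))"
      using inverse_power_summable[of 2, where 'a=real] by (intro summable_mult) (simp add: inverse_eq_divide)
  qed
  then show ?thesis
  proof eventually_elim
    case (elim x)
    have bound: "\<bar>(\<Sum>i<n. X i x) / real n\<bar> \<le> 2 * sqrt (Y (floor_sqrt n) x)" if n: "n > 0" for n
    proof -
      define m where "m = floor_sqrt n"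
      have m: "m > 0" "m\<^sup>2 \<le> n" "n < (Suc m)\<^sup>2"
        using n by (auto simp: m_def Suc_floor_sqrt_power2_gt)
      have "S n x = S (m\<^sup>2) x + (\<Sum>i\<in>{m\<^sup>2..<n}. X i x)"
        unfolding S_def using m(2) by (metis lessThan_atLeast0 sum.atLeastLessThan_concat zero_le)
      then have S: "\<bar>S n x\<bar> \<le> \<bar>S (m\<^sup>2) x\<bar> + \<bar>\<Sum>i\<in>{m\<^sup>2..<n}. X i x\<bar>" by simp
      have Q: "0 \<le> (\<Sum>i\<in>B m. (X i x)\<^sup>2)" by (intro sum_nonneg) auto
      have "(S (m\<^sup>2) x)\<^sup>2 \<le> Y m x * real m ^ 4" using m Q by (simp add: Y_def)
      then have 1: "\<bar>S (m\<^sup>2) x\<bar> \<le> sqrt (Y m x * real m ^ 4)" by (simp add: real_le_rsqrt)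
      have "(\<Sum>i\<in>{m\<^sup>2..<n}. X i x)\<^sup>2 \<le> (\<Sum>i\<in>{m\<^sup>2..<n}. (X i x)\<^sup>2) * card {m\<^sup>2..<n}"
        by (rule sum_squared_le_sum_of_squares)
      also have "\<dots> \<le> (\<Sum>i\<in>B m. (X i x)\<^sup>2) * card (B m)"
        using m by (intro mult_mono sum_mono2 of_nat_mono card_mono sum_nonneg) (auto simp: B_def)
      also have "\<dots> = (2 * real m + 1) * (\<Sum>i\<in>B m. (X i x)\<^sup>2)" by (simp add: cardB algebra_simps)
      also have "\<dots> \<le> Y m x * real m ^ 4" using m by (simp add: Y_def)
      finally have 2: "\<bar>\<Sum>i\<in>{m\<^sup>2..<n}. X i x\<bar> \<le> sqrt (Y m x * real m ^ 4)" by (simp add: real_le_rsqrt)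
      have "sqrt (Y m x * real m ^ 4) = sqrt (Y m x) * (real m)\<^sup>2"
      proof -
        have "real m ^ 4 = ((real m)\<^sup>2)\<^sup>2" by simp
        then show ?thesis by (simp only: real_sqrt_mult real_sqrt_abs) simp
      qed
      then have "\<bar>S n x\<bar> \<le> 2 * sqrt (Y m x) * (real m)\<^sup>2" using S 1 2 by simp
      also have "\<dots> \<le> 2 * sqrt (Y m x) * real n"
      proof -
        have "0 \<le> Y m x" unfolding Y_def using Q by auto
        moreover have "(real m)\<^sup>2 \<le> real n" using m(2) by (metis of_nat_le_iff of_nat_power)
        ultimately show ?thesis by (intro mult_left_mono) auto
      qed
      finally show ?thesis using n by (simp add: S_def m_def divide_simps)
    qed
    have "filterlim floor_sqrt at_top at_top"
      unfolding filterlim_at_top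
    proof
      fix k
      have "k \<le> floor_sqrt n" if "k\<^sup>2 \<le> n" for n
        using mono_floor_sqrt'[OF that] by simp
      then show "\<forall>\<^sub>F n in at_top. k \<le> floor_sqrt n"
        unfolding eventually_at_top_linorder by blast
    qed
    from filterlim_compose[OF elim this]
    have "(\<lambda>n. 2 * sqrt (Y (floor_sqrt n) x)) \<longlonglongrightarrow> 2 * sqrt 0"
      by (intro tendsto_intros)
    then have "(\<lambda>n. 2 * sqrt (Y (floor_sqrt n) x)) \<longlonglongrightarrow> 0" by simp
    then show ?case
      by (rule Lim_null_comparison[rotated])
        (use bound in \<open>auto intro!: eventually_mono[OF eventually_gt_at_top[of 0]]\<close>)
  qed
qed

section \<open>The invariant measure and duality\<close>

definition gauss_measure :: "nat \<Rightarrow> real measure" where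
  "gauss_measure N = density lborel (\<lambda>x. ennreal (indicator {0<..1} x / (real N + x)))"

lemma sets_gauss_measure [simp, measurable_cong]: "sets (gauss_measure N) = sets borel"
  by (simp add: gauss_measure_def)

lemma space_gauss_measure [simp]: "space (gauss_measure N) = UNIV"
  by (simp add: gauss_measure_def)

lemma gauss_map_measurable [measurable]: "gauss_map N \<in> borel_measurable borel"
  unfolding gauss_map_def[abs_def] frac_def by measurable

lemma branch_measurable [measurable]: "(\<lambda>s. branch N s j) \<in> borel_measurable borel"
  unfolding branch_def by measurable

lemma weight_measurable [measurable]: "(\<lambda>s. weight N s j) \<in> borel_measurable borel"
  unfolding weight_def by measurable

lemma transfer_measurable [measurable]:
  assumes [measurable]: "f \<in> borel_measurable borel"
  shows "gauss_transfer N f \<in> borel_measurable borel"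
  unfolding gauss_transfer_def[abs_def] by measurable

lemma gauss_map_branch:
  assumes "N > 0" "u \<in> {0..<1}"
  shows "gauss_map N (branch N u j) = u"
proof -
  have "branch N u j > 0" using assms by (intro branch_bounds) auto
  moreover have "real N / branch N u j = of_nat (N + j) + u"
    using assms by (simp add: branch_def)
  moreover have "frac (of_nat (N + j) + u) = u"
    using assms by (simp add: frac_unique_iff)
  ultimately show ?thesis by (simp add: gauss_map_def)
qed

text \<open>
  The substitution \<open>t = N/(N+j+u)\<close> reverses orientation, whereas the substitution rule wants an
  increasing function; the proof therefore substitutes with \<open>v = -u\<close> and reflects afterwards.
\<close>

lemma nn_integral_branch_substitution:
  fixes F :: "real \<Rightarrow> ennreal"
  assumes N: "N > 0" and F [measurable]: "F \<in> borel_measurable borel"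
  shows "(\<integral>\<^sup>+t\<in>{branch N 1 j<..branch N 0 j}. F t \<partial>lborel) =
    (\<integral>\<^sup>+u. F (branch N u j) * ennreal (real N / (real N + real j + u)\<^sup>2) * indicator {0<..1} u \<partial>lborel)"
proof -
  define k where "k = real N + real j"
  have k: "k > 0" using N by (simp add: k_def)
  define g where "g v = real N / (k - v)" for v
  define g' where "g' v = real N / (k - v)\<^sup>2" for v
  have "(\<integral>\<^sup>+t\<in>{branch N 1 j<..branch N 0 j}. F t \<partial>lborel) =
      (\<integral>\<^sup>+t. F t * indicator {g (-1)..g 0} t \<partial>lborel)"
    using AE_lborel_singleton[of "g (-1)"]
    by (intro nn_integral_cong_AE) (auto simp: branch_def g_def k_def[symmetric] indicator_def add_ac elim!: eventually_mono)
  also have "\<dots> = (\<integral>\<^sup>+v. F (g v) * ennreal (g' v) * indicator {-1..0} v \<partial>lborel)"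
  proof (rule nn_integral_substitution_aux)
    show "(g has_real_derivative g' v) (at v)" if "v \<in> {-1..0}" for v
      unfolding g_def g'_def using that k by (auto intro!: derivative_eq_intros simp: power2_eq_square)
    show "continuous_on {-1..0} g'"
      unfolding g'_def using k by (intro continuous_intros) auto
  qed (use k in \<open>auto simp: g'_def\<close>)
  also have "\<dots> = (\<integral>\<^sup>+u. F (g (-u)) * ennreal (g' (-u)) * indicator {-1..0} (-u) \<partial>lborel)"
    by (subst nn_integral_real_affine[where c="-1" and t=0]) (auto simp: g_def g'_def)
  also have "\<dots> = (\<integral>\<^sup>+u. F (branch N u j) * ennreal (real N / (real N + real j + u)\<^sup>2) * indicator {0<..1} u \<partial>lborel)"
    using AE_lborel_singleton[of 0]
    by (intro nn_integral_cong_AE) (auto simp: branch_def g_def g'_def k_def[symmetric] indicator_def elim!: eventually_mono)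
  finally show ?thesis .
qed

lemma branch_intervals_union:
  assumes N: "N > 0"
  shows "(\<Union>j. {branch N 1 j<..branch N 0 j}) = {0<..1}"
proof (intro equalityI subsetI)
  fix t assume "t \<in> (\<Union>j. {branch N 1 j<..branch N 0 j})"
  then obtain j where "branch N 1 j < t" "t \<le> branch N 0 j" by auto
  then show "t \<in> {0<..1}" using branch_bounds[OF N, of 1 j] branch_bounds[OF N, of 0 j] by auto
next
  fix t :: real assume t: "t \<in> {0<..1}"
  have Nt: "real N \<le> real N / t" using t N by (simp add: field_simps mult_left_le)
  define j where "j = nat (\<lfloor>real N / t\<rfloor> - int N)"
  have "int N \<le> \<lfloor>real N / t\<rfloor>" using Nt by (simp add: le_floor_iff)
  then have "real_of_int \<lfloor>real N / t\<rfloor> = real N + real j" unfolding j_def by simp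
  then have "real N + real j \<le> real N / t" "real N / t < real N + real j + 1" by linarith+
  then have "branch N 1 j < t" "t \<le> branch N 0 j"
    using t N by (auto simp: branch_def field_simps)
  then show "t \<in> (\<Union>j. {branch N 1 j<..branch N 0 j})" by auto
qed

lemma branch_intervals_disjoint:
  assumes N: "N > 0"
  shows "disjoint_family (\<lambda>j. {branch N 1 j<..branch N 0 j})"
proof -
  have "branch N 0 j \<le> branch N 1 i" if "i < j" for i j
    using that N unfolding branch_def by (intro divide_left_mono mult_pos_pos) auto
  then have "{branch N 1 i<..branch N 0 i} \<inter> {branch N 1 j<..branch N 0 j} = {}" if "i < j" for i j
    using that by fastforce
  then show ?thesis
    unfolding disjoint_family_on_def by (metis inf_commute linorder_neqE_nat)
qed

text \<open>
  The change of variables formula on each branch; the weights are made so that the density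
  times the Jacobian of branch \<open>j\<close> is the density times \<open>weight N u j\<close>.
\<close>

lemma nn_integral_transfer:
  fixes F :: "real \<Rightarrow> ennreal"
  assumes N: "N > 0" and F [measurable]: "F \<in> borel_measurable borel"
  shows "(\<integral>\<^sup>+t. F t \<partial>gauss_measure N) =
    (\<integral>\<^sup>+u. (\<Sum>j. ennreal (weight N u j) * F (branch N u j)) \<partial>gauss_measure N)"
proof -
  define G where "G t = ennreal (1 / (real N + t)) * F t" for t
  have [measurable]: "G \<in> borel_measurable borel" unfolding G_def by measurable
  have "(\<integral>\<^sup>+t. F t \<partial>gauss_measure N) = (\<integral>\<^sup>+t\<in>{0<..1}. G t \<partial>lborel)"
    unfolding gauss_measure_def by (subst nn_integral_density)
      (auto intro!: nn_integral_cong simp: G_def indicator_def)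
  also have "\<dots> = (\<Sum>j. \<integral>\<^sup>+t\<in>{branch N 1 j<..branch N 0 j}. G t \<partial>lborel)"
    unfolding branch_intervals_union[OF N, symmetric]
    by (intro nn_integral_disjoint_family branch_intervals_disjoint N) auto
  also have "\<dots> = (\<Sum>j. \<integral>\<^sup>+u. ennreal (indicator {0<..1} u / (real N + u)) *
      (ennreal (weight N u j) * F (branch N u j)) \<partial>lborel)"
  proof (intro suminf_cong)
    fix j
    have "G (branch N u j) * ennreal (real N / (real N + real j + u)\<^sup>2) * indicator {0<..1} u =
        ennreal (indicator {0<..1} u / (real N + u)) * (ennreal (weight N u j) * F (branch N u j))" for u
    proof (cases "u \<in> {0<..1}")
      case True
      define k where "k = real N + real j + u"
      have p: "k > 0" "real N + u > 0" using True N by (auto simp: k_def add_pos_nonneg)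
      have "1 / (real N + branch N u j) * (real N / k\<^sup>2) = 1 / (real N + u) * weight N u j"
      proof -
        have "real N + branch N u j = real N * (k + 1) / k"
          unfolding branch_def k_def[symmetric] using p by (simp add: field_simps)
        then have "1 / (real N + branch N u j) * (real N / k\<^sup>2) = 1 / (k * (k + 1))"
          using p N by (simp add: divide_simps power2_eq_square)
        also have "\<dots> = 1 / (real N + u) * weight N u j"
          unfolding weight_def using p by (simp add: k_def add_ac)
        finally show ?thesis .
      qed
      moreover have "0 \<le> 1 / (real N + branch N u j)" "0 \<le> 1 / (real N + u)"
        using p branch_bounds[OF N, of u j] True by auto
      ultimately have "ennreal (1 / (real N + branch N u j)) * ennreal (real N / k\<^sup>2) =
          ennreal (1 / (real N + u)) * ennreal (weight N u j)"
        by (metis ennreal_mult')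
      then show ?thesis using True unfolding G_def k_def
        by (simp add: mult_ac)
    qed simp
    then show "(\<integral>\<^sup>+t\<in>{branch N 1 j<..branch N 0 j}. G t \<partial>lborel) =
        (\<integral>\<^sup>+u. ennreal (indicator {0<..1} u / (real N + u)) *
          (ennreal (weight N u j) * F (branch N u j)) \<partial>lborel)"
      by (subst nn_integral_branch_substitution[OF N]) simp_all
  qed
  also have "\<dots> = (\<integral>\<^sup>+u. (\<Sum>j. ennreal (indicator {0<..1} u / (real N + u)) *
      (ennreal (weight N u j) * F (branch N u j))) \<partial>lborel)"
    by (intro nn_integral_suminf[symmetric]) measurable
  also have "\<dots> = (\<integral>\<^sup>+u. (\<Sum>j. ennreal (weight N u j) * F (branch N u j)) \<partial>gauss_measure N)"
    unfolding gauss_measure_def by (subst nn_integral_density) (auto intro!: nn_integral_cong)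
  finally show ?thesis .
qed

lemma AE_gauss_measure: "AE x in gauss_measure N. x \<in> {0<..<1}"
proof -
  have "AE x in lborel. x \<noteq> (1::real)" by (rule AE_lborel_singleton)
  then show ?thesis unfolding gauss_measure_def
    by (subst AE_density) (auto elim!: eventually_mono simp: indicator_def split: if_splits)
qed

text \<open>
  Duality between composition with the map and the transfer operator, expressed as an equality of measures.
  In this form it can be integrated against functions of any sign without integrability
  conditions. The series is required to converge only on \<open>[0,1)\<close>, because a function of the
  coefficient \<open>\<lfloor>N/x\<rfloor>\<close> takes the value belonging to \<open>N + j\<close> on branch \<open>j\<close> only for \<open>s < 1\<close>.
\<close>

lemma distr_density_gauss_map:
  assumes N: "N > 0" and f [measurable]: "f \<in> borel_measurable borel"
    and nonneg: "\<And>x. x \<in> {0<..1} \<Longrightarrow> 0 \<le> f x"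
    and summ: "\<And>s. s \<in> {0..<1} \<Longrightarrow> summable (\<lambda>j. weight N s j * f (branch N s j))"
  shows "distr (density (gauss_measure N) f) borel (gauss_map N) = density (gauss_measure N) (gauss_transfer N f)"
proof (rule measure_eqI)
  fix A assume "A \<in> sets (distr (density (gauss_measure N) (\<lambda>x. ennreal (f x))) borel (gauss_map N))"
  then have [measurable]: "A \<in> sets borel" by simp
  have "emeasure (distr (density (gauss_measure N) f) borel (gauss_map N)) A =
      (\<integral>\<^sup>+x. indicator A (gauss_map N x) \<partial>density (gauss_measure N) f)"
    by (simp flip: nn_integral_indicator add: nn_integral_distr)
  also have "\<dots> = (\<integral>\<^sup>+t. ennreal (f t) * indicator A (gauss_map N t) \<partial>gauss_measure N)"
    by (subst nn_integral_density) auto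
  also have "\<dots> = (\<integral>\<^sup>+u. (\<Sum>j. ennreal (weight N u j) * (ennreal (f (branch N u j)) *
      indicator A (gauss_map N (branch N u j)))) \<partial>gauss_measure N)"
    by (rule nn_integral_transfer[OF N]) measurable
  also have "\<dots> = (\<integral>\<^sup>+u. ennreal (gauss_transfer N f u) * indicator A u \<partial>gauss_measure N)"
    using AE_gauss_measure
  proof (intro nn_integral_cong_AE, eventually_elim)
    case (elim u)
    have "(\<Sum>j. ennreal (weight N u j) * (ennreal (f (branch N u j)) * indicator A (gauss_map N (branch N u j))))
       = (\<Sum>j. ennreal (weight N u j * f (branch N u j)) * indicator A u)"
      using elim N nonneg branch_bounds[of N u]
      by (intro suminf_cong) (simp add: gauss_map_branch ennreal_mult weight_nonneg mult_ac)
    also have "\<dots> = (\<Sum>j. ennreal (weight N u j * f (branch N u j))) * indicator A u"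
      by simp
    also have "(\<Sum>j. ennreal (weight N u j * f (branch N u j))) = ennreal (gauss_transfer N f u)"
      unfolding gauss_transfer_def using elim N nonneg branch_bounds[of N u]
      by (intro suminf_ennreal2 summ) (auto simp: weight_nonneg)
    finally show ?case .
  qed
  also have "\<dots> = emeasure (density (gauss_measure N) (gauss_transfer N f)) A"
    by (subst emeasure_density) auto
  finally show "emeasure (distr (density (gauss_measure N) f) borel (gauss_map N)) A =
    emeasure (density (gauss_measure N) (gauss_transfer N f)) A" .
qed simp

lemma integral_mult_gauss_map:
  assumes N: "N > 0" and f [measurable]: "f \<in> borel_measurable borel"
    and nonneg: "\<And>x. x \<in> {0<..1} \<Longrightarrow> 0 \<le> f x"
    and summ: "\<And>s. s \<in> {0..<1} \<Longrightarrow> summable (\<lambda>j. weight N s j * f (branch N s j))"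
    and w [measurable]: "w \<in> borel_measurable borel"
  shows "(\<integral>x. f x * w (gauss_map N x) \<partial>gauss_measure N) = (\<integral>x. gauss_transfer N f x * w x \<partial>gauss_measure N)"
proof -
  have f0: "AE x in gauss_measure N. 0 \<le> f x"
    using AE_gauss_measure by eventually_elim (use nonneg in auto)
  have U0: "0 \<le> gauss_transfer N f s" if "s \<in> {0..<1}" for s
    unfolding gauss_transfer_def using that branch_bounds[OF N, of s]
    by (intro suminf_nonneg summ mult_nonneg_nonneg weight_nonneg nonneg) auto
  have u0: "AE x in gauss_measure N. 0 \<le> gauss_transfer N f x"
    using AE_gauss_measure by eventually_elim (use U0 in auto)
  have "(\<integral>x. f x * w (gauss_map N x) \<partial>gauss_measure N) =
      (\<integral>x. w (gauss_map N x) \<partial>density (gauss_measure N) f)"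
    using f0 by (subst integral_density) auto
  also have "\<dots> = (\<integral>x. w x \<partial>distr (density (gauss_measure N) f) borel (gauss_map N))"
    by (subst integral_distr) auto
  also have "\<dots> = (\<integral>x. w x \<partial>density (gauss_measure N) (gauss_transfer N f))"
    by (subst distr_density_gauss_map[OF N f nonneg summ]) auto
  also have "\<dots> = (\<integral>x. gauss_transfer N f x * w x \<partial>gauss_measure N)"
    using u0 by (subst integral_density) auto
  finally show ?thesis .
qed

lemma gauss_measure_invariant:
  assumes N: "N > 0"
  shows "distr (gauss_measure N) borel (gauss_map N) = gauss_measure N"
proof -
  have 1: "summable (weight N s)" "(\<Sum>j. weight N s j) = 1" if "0 \<le> s" for s
    using weight_sums[OF N that] by (auto simp: sums_iff)
  have "distr (density (gauss_measure N) (\<lambda>_. ennreal 1)) borel (gauss_map N) =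
      density (gauss_measure N) (gauss_transfer N (\<lambda>_. 1))"
    using 1 by (intro distr_density_gauss_map N) auto
  also have "\<dots> = density (gauss_measure N) (\<lambda>_. ennreal 1)"
  proof (rule density_cong)
    show "AE x in gauss_measure N. ennreal (gauss_transfer N (\<lambda>_. 1) x) = ennreal 1"
      using AE_gauss_measure by eventually_elim (simp add: gauss_transfer_def 1)
  qed auto
  finally show ?thesis by (simp add: density_1)
qed

lemma gauss_map_iter_measurable [measurable]: "gauss_map N ^^ k \<in> borel_measurable borel"
proof (induction k)
  case (Suc k)
  then have [measurable]: "gauss_map N ^^ k \<in> borel_measurable borel" .
  show ?case unfolding funpow.simps(2) by measurable
qed simp

lemma gauss_measure_invariant_iter:
  assumes N: "N > 0"
  shows "distr (gauss_measure N) borel (gauss_map N ^^ k) = gauss_measure N"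
proof (induction k)
  case 0
  show ?case by (simp add: distr_id2)
next
  case (Suc k)
  have "distr (gauss_measure N) borel (gauss_map N ^^ Suc k) =
      distr (distr (gauss_measure N) borel (gauss_map N ^^ k)) borel (gauss_map N)"
    unfolding funpow.simps(2) by (subst distr_distr) auto
  also have "\<dots> = gauss_measure N" by (simp only: Suc.IH gauss_measure_invariant[OF N])
  finally show ?case .
qed

lemma integral_gauss_map_iter:
  assumes N: "N > 0" and g [measurable]: "(g :: real \<Rightarrow> real) \<in> borel_measurable borel"
  shows "(\<integral>x. g ((gauss_map N ^^ k) x) \<partial>gauss_measure N) = (\<integral>x. g x \<partial>gauss_measure N)"
    and "integrable (gauss_measure N) (\<lambda>x. g ((gauss_map N ^^ k) x)) \<longleftrightarrow> integrable (gauss_measure N) g"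
proof -
  show "(\<integral>x. g ((gauss_map N ^^ k) x) \<partial>gauss_measure N) = (\<integral>x. g x \<partial>gauss_measure N)"
    by (subst (2) gauss_measure_invariant_iter[OF N, symmetric, of k]) (subst integral_distr; simp)
  show "integrable (gauss_measure N) (\<lambda>x. g ((gauss_map N ^^ k) x)) \<longleftrightarrow> integrable (gauss_measure N) g"
    by (subst (2) gauss_measure_invariant_iter[OF N, symmetric, of k]) (subst integrable_distr_eq; simp)
qed

lemma AE_gauss_map_iter:
  assumes N: "N > 0"
  shows "AE x in gauss_measure N. \<forall>k. (gauss_map N ^^ k) x \<in> {0<..<1}"
proof -
  have "AE x in gauss_measure N. (gauss_map N ^^ k) x \<in> {0<..<1}" for k
  proof -
    have "AE x in distr (gauss_measure N) borel (gauss_map N ^^ k). x \<in> {0<..<1}"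
      unfolding gauss_measure_invariant_iter[OF N] by (rule AE_gauss_measure)
    then show ?thesis by (subst (asm) AE_distr_iff) auto
  qed
  then show ?thesis by (simp add: AE_all_countable)
qed

lemma finite_measure_gauss_measure:
  assumes N: "N > 0"
  shows "finite_measure (gauss_measure N)"
proof
  have "emeasure (gauss_measure N) UNIV = (\<integral>\<^sup>+x. ennreal (indicator {0<..1} x / (real N + x)) \<partial>lborel)"
    unfolding gauss_measure_def by (subst emeasure_density) auto
  also have "\<dots> \<le> (\<integral>\<^sup>+x. indicator {0<..1::real} x \<partial>lborel)"
  proof (intro nn_integral_mono)
    fix x :: real
    have "1 / (real N + x) \<le> 1" if "0 < x" using that N by simp
    then show "ennreal (indicator {0<..1} x / (real N + x)) \<le> indicator {0<..1} x"
      by (auto simp: indicator_def intro: order.trans[OF ennreal_leI, of _ 1])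
  qed
  also have "\<dots> = 1" by simp
  finally show "emeasure (gauss_measure N) (space (gauss_measure N)) \<noteq> \<infinity>"
    by (auto simp: top_unique)
qed

section \<open>Almost sure convergence of orbit averages\<close>

text \<open>
  The function \<open>D = f - U f \<circ> T\<close> is orthogonal to all functions \<open>w \<circ> T\<close>, because \<open>f \<cdot> (w \<circ> T)\<close> and
  \<open>(U f \<circ> T) \<cdot> (w \<circ> T)\<close> both have the integral of \<open>U f \<cdot> w\<close>, the first by duality, the second by invariance. So the
  \<open>D \<circ> T\<^sup>k\<close> obey the strong law. Replacing \<open>U f (T\<^sup>k\<^sup>+\<^sup>1 x)\<close> by \<open>U f (T\<^sup>k x)\<close> changes the sum by a telescoping,
  hence bounded, amount.
\<close>

lemma AE_average_diff_transfer:
  assumes N: "N > 0" and f [measurable]: "f \<in> borel_measurable borel"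
    and nonneg: "\<And>x. x \<in> {0<..1} \<Longrightarrow> 0 \<le> f x"
    and summ: "\<And>s. s \<in> {0..<1} \<Longrightarrow> summable (\<lambda>j. weight N s j * f (branch N s j))"
    and sq: "integrable (gauss_measure N) (\<lambda>x. (f x)\<^sup>2)"
    and bound: "\<And>s. s \<in> {0..<1} \<Longrightarrow> \<bar>gauss_transfer N f s\<bar> \<le> C"
  shows "AE x in gauss_measure N. (\<lambda>n. (\<Sum>k<n. f ((gauss_map N ^^ k) x) -
    gauss_transfer N f ((gauss_map N ^^ k) x)) / real n) \<longlonglongrightarrow> 0"
proof -
  interpret finite_measure "gauss_measure N" by (rule finite_measure_gauss_measure[OF N])
  let ?M = "gauss_measure N" and ?T = "gauss_map N" and ?U = "gauss_transfer N f"
  define D where "D x = f x - ?U (?T x)" for x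
  have [measurable]: "D \<in> borel_measurable borel" unfolding D_def by measurable
  have AE_bound: "AE x in ?M. \<bar>?U (?T x)\<bar> \<le> C"
    using gauss_map_range[of N] by (intro AE_I2 bound) (auto simp: less_imp_le)
  have Usq: "integrable ?M (\<lambda>x. (?U (?T x))\<^sup>2)"
  proof (rule integrable_const_bound)
    show "AE x in ?M. norm ((?U (?T x))\<^sup>2) \<le> C\<^sup>2"
      using AE_bound by eventually_elim (simp add: abs_le_square_iff[symmetric])
  qed simp
  have prod: "integrable ?M (\<lambda>x. a x * b x)"
    if [measurable]: "a \<in> borel_measurable borel" "b \<in> borel_measurable borel"
      and "integrable ?M (\<lambda>x. (a x)\<^sup>2)" "integrable ?M (\<lambda>x. (b x)\<^sup>2)" for a b :: "real \<Rightarrow> real"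
  proof (rule Bochner_Integration.integrable_bound)
    show "integrable ?M (\<lambda>x. (a x)\<^sup>2 + (b x)\<^sup>2)" using that by simp
    show "AE x in ?M. norm (a x * b x) \<le> norm ((a x)\<^sup>2 + (b x)\<^sup>2)"
      by (auto simp: abs_mult_le_squares)
  qed simp
  have Dsq: "integrable ?M (\<lambda>x. (D x)\<^sup>2)"
  proof -
    have "(D x)\<^sup>2 = (f x)\<^sup>2 + (?U (?T x))\<^sup>2 - 2 * (f x * ?U (?T x))" for x
      by (simp add: D_def power2_eq_square algebra_simps)
    then show ?thesis using sq Usq prod[OF _ _ sq Usq] by simp
  qed
  have orth: "(\<integral>x. D x * D ((?T ^^ Suc m) x) \<partial>?M) = 0" for m
  proof -
    define w where "w x = D ((?T ^^ m) x)" for x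
    have w [measurable]: "w \<in> borel_measurable borel" unfolding w_def by measurable
    have wT: "D ((?T ^^ Suc m) x) = w (?T x)" for x by (simp add: w_def funpow_swap1)
    have Dw: "D x * w (?T x) = (f x - ?U (?T x)) * w (?T x)" for x by (simp add: D_def)
    have wsq: "integrable ?M (\<lambda>x. (w (?T x))\<^sup>2)"
      unfolding wT[symmetric] by (subst integral_gauss_map_iter(2)[OF N, where g="\<lambda>x. (D x)\<^sup>2"]) (auto intro: Dsq)
    have "(\<integral>x. D x * D ((?T ^^ Suc m) x) \<partial>?M) =
        (\<integral>x. f x * w (?T x) \<partial>?M) - (\<integral>x. ?U (?T x) * w (?T x) \<partial>?M)"
      unfolding wT Dw left_diff_distrib
      using prod[OF _ _ sq wsq] prod[OF _ _ Usq wsq] by (intro Bochner_Integration.integral_diff) auto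
    also have "(\<integral>x. f x * w (?T x) \<partial>?M) = (\<integral>x. ?U x * w x \<partial>?M)"
      by (rule integral_mult_gauss_map[OF N f nonneg summ w])
    also have "(\<integral>x. ?U (?T x) * w (?T x) \<partial>?M) = (\<integral>x. ?U x * w x \<partial>?M)"
      using integral_gauss_map_iter(1)[OF N, of "\<lambda>x. ?U x * w x" 1] by simp
    finally show ?thesis by simp
  qed
  have "AE x in ?M. (\<lambda>n. (\<Sum>k<n. D ((?T ^^ k) x)) / real n) \<longlonglongrightarrow> 0"
  proof (rule orthogonal_strong_law)
    show "(\<lambda>x. D ((?T ^^ i) x)) \<in> borel_measurable ?M" for i by measurable
    show "integrable ?M (\<lambda>x. (D ((?T ^^ i) x))\<^sup>2)" for i
      by (subst integral_gauss_map_iter(2)[OF N, where g="\<lambda>x. (D x)\<^sup>2"]) (auto intro: Dsq)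
    show "(\<integral>x. (D ((?T ^^ i) x))\<^sup>2 \<partial>?M) \<le> (\<integral>x. (D x)\<^sup>2 \<partial>?M)" for i
      by (subst integral_gauss_map_iter(1)[OF N, where g="\<lambda>x. (D x)\<^sup>2"]) auto
    show "(\<integral>x. D ((?T ^^ i) x) * D ((?T ^^ j) x) \<partial>?M) = 0" if ij: "i < j" for i j
    proof -
      obtain m where m: "j = Suc m + i" using less_imp_Suc_add[OF ij] by auto
      have "(?T ^^ j) x = (?T ^^ Suc m) ((?T ^^ i) x)" for x unfolding m funpow_add by simp
      then show ?thesis
        using integral_gauss_map_iter(1)[OF N, of "\<lambda>y. D y * D ((?T ^^ Suc m) y)" i] orth[of m] by simp
    qed
  qed
  then show ?thesis using AE_gauss_map_iter[OF N]
  proof eventually_elim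
    case (elim x)
    have bd: "\<bar>?U ((?T ^^ k) x)\<bar> \<le> C" for k
      using elim(2) by (intro bound) (auto simp: less_imp_le)
    have eq: "(\<Sum>k<n. f ((?T ^^ k) x) - ?U ((?T ^^ k) x)) / real n =
        (\<Sum>k<n. D ((?T ^^ k) x)) / real n + (?U ((?T ^^ n) x) - ?U x) / real n" for n
    proof -
      have "(\<Sum>k<n. f ((?T ^^ k) x) - ?U ((?T ^^ k) x)) = (\<Sum>k<n. D ((?T ^^ k) x)) + (?U ((?T ^^ n) x) - ?U x)"
        by (induction n) (auto simp: D_def)
      then show ?thesis by (simp add: add_divide_distrib)
    qed
    have "(\<lambda>n. (?U ((?T ^^ n) x) - ?U x) / real n) \<longlonglongrightarrow> 0"
    proof (rule Lim_null_comparison)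
      show "(\<lambda>n. 2 * C / real n) \<longlonglongrightarrow> 0" by real_asymp
      have "\<bar>?U ((?T ^^ n) x) - ?U x\<bar> \<le> 2 * C" for n using bd[of n] bd[of 0] by simp
      then show "\<forall>\<^sub>F n in sequentially. norm ((?U ((?T ^^ n) x) - ?U x) / real n) \<le> 2 * C / real n"
        by (auto intro!: always_eventually divide_right_mono)
    qed
    from tendsto_add[OF elim(1) this] show ?case unfolding eq by simp
  qed
qed

text \<open>
  The averages of \<open>f\<close> agree asymptotically with those of \<open>h m = U\<^sup>m g\<close> for every \<open>m\<close>, and \<open>h m\<close> is constant up to
  \<open>(7/8)\<^sup>m L\<close>. The function \<open>g\<close> is a Lipschitz version of \<open>U f\<close> on the closed interval:
  if \<open>f\<close> depends on the coefficient only, \<open>U f\<close> itself has the wrong value at \<open>s = 1\<close>, and this point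
  matters for the next application of \<open>U\<close>, as it is the image of 0 under branch 0.
\<close>

lemma AE_ergodic_average:
  assumes N: "N > 0" and f [measurable]: "f \<in> borel_measurable borel"
    and nonneg: "\<And>x. x \<in> {0<..1} \<Longrightarrow> 0 \<le> f x"
    and summ: "\<And>s. s \<in> {0..<1} \<Longrightarrow> summable (\<lambda>j. weight N s j * f (branch N s j))"
    and sq: "integrable (gauss_measure N) (\<lambda>x. (f x)\<^sup>2)"
    and transfer: "\<And>s. s \<in> {0..<1} \<Longrightarrow> gauss_transfer N f s = g s"
    and g [measurable]: "g \<in> borel_measurable borel"
    and lip: "\<And>s t. s \<in> {0..1} \<Longrightarrow> t \<in> {0..1} \<Longrightarrow> \<bar>g s - g t\<bar> \<le> L * \<bar>s - t\<bar>"
    and bounds: "\<And>s. s \<in> {0..1} \<Longrightarrow> lo \<le> g s \<and> g s \<le> hi"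
    and lo: "0 \<le> lo"
  shows "\<exists>c. lo \<le> c \<and> c \<le> hi \<and>
    (AE x in gauss_measure N. (\<lambda>n. (\<Sum>k<n. f ((gauss_map N ^^ k) x)) / real n) \<longlonglongrightarrow> c)"
proof -
  interpret finite_measure "gauss_measure N" by (rule finite_measure_gauss_measure[OF N])
  let ?T = "gauss_map N"
  define h where "h m = (gauss_transfer N ^^ m) g" for m
  have h0: "h 0 = g" and hSuc: "h (Suc m) = gauss_transfer N (h m)" for m by (simp_all add: h_def)
  have L: "0 \<le> L" using lip[of 0 1] by simp
  have [measurable]: "h m \<in> borel_measurable borel" for m
    by (induction m) (auto simp: h0 hSuc)
  have hb: "lo \<le> h m s \<and> h m s \<le> hi" if "s \<in> {0..1}" for m s
    using that
  proof (induction m arbitrary: s)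
    case (Suc m)
    then show ?case using transfer_bounds[OF N, of s lo "h m" hi] by (auto simp: hSuc)
  qed (auto simp: h0 bounds)
  have hlip: "\<bar>h m s - h m t\<bar> \<le> (7/8)^m * L * \<bar>s - t\<bar>" if "s \<in> {0..1}" "t \<in> {0..1}" for m s t
    using that
  proof (induction m arbitrary: s t)
    case (Suc m)
    show ?case unfolding hSuc
      using transfer_contracts_lipschitz[OF N _ Suc.IH Suc.prems] L by (simp add: mult_ac)
  qed (auto simp: h0 lip)
  have osc: "\<bar>h m s - h m 0\<bar> \<le> (7/8)^m * L" if "s \<in> {0..1}" for m s
  proof -
    have "(7/8)^m * L * \<bar>s - 0\<bar> \<le> (7/8)^m * L * 1" using that L by (intro mult_left_mono) auto
    then show ?thesis using order.trans[OF hlip[OF that, of 0 m]] by simp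
  qed
  have step: "\<bar>h (Suc m) 0 - h m 0\<bar> \<le> (7/8)^m * L" for m
  proof -
    have bd: "h m 0 - (7/8)^m * L \<le> h m x \<and> h m x \<le> h m 0 + (7/8)^m * L" if "0 < x" "x \<le> 1" for x
      using osc[of x m] that by auto
    show ?thesis
      using transfer_bounds[where f="h m", OF N order_refl bd]
      unfolding hSuc by linarith
  qed
  have geo: "summable (\<lambda>m. (7/8)^m * L)" by (intro summable_mult2 summable_geometric) simp
  have "summable (\<lambda>m. h (Suc m) 0 - h m 0)"
    using step by (intro summable_comparison_test[OF _ geo]) auto
  then obtain S where "(\<lambda>m. h (Suc m) 0 - h m 0) sums S" by (auto simp: summable_def)
  then have "(\<lambda>n. h n 0 - h 0 0) \<longlonglongrightarrow> S"
    unfolding sums_def sum_lessThan_telescope[of "\<lambda>m. h m 0"] .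
  from tendsto_add[OF this tendsto_const[of "h 0 0"]]
  obtain c where c: "(\<lambda>m. h m 0) \<longlonglongrightarrow> c" by auto
  have c_bounds: "lo \<le> c" "c \<le> hi"
    using hb[of 0] by (auto intro: tendsto_lowerbound[OF c] tendsto_upperbound[OF c])
  have "AE x in gauss_measure N. (\<lambda>n. (\<Sum>k<n. f ((?T ^^ k) x) - h 0 ((?T ^^ k) x)) / real n) \<longlonglongrightarrow> 0"
  proof -
    have "\<bar>gauss_transfer N f s\<bar> \<le> hi" if "s \<in> {0..<1}" for s
      using bounds[of s] lo that by (auto simp: transfer)
    then have "AE x in gauss_measure N. (\<lambda>n. (\<Sum>k<n. f ((?T ^^ k) x) -
        gauss_transfer N f ((?T ^^ k) x)) / real n) \<longlonglongrightarrow> 0"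
      by (intro AE_average_diff_transfer[OF N f nonneg summ sq])
    then show ?thesis using AE_gauss_map_iter[OF N]
    proof eventually_elim
      case (elim x)
      have "gauss_transfer N f ((?T ^^ k) x) = g ((?T ^^ k) x)" for k
        using elim(2) by (intro transfer) (auto simp: less_imp_le)
      then show ?case using elim(1) by (simp add: h0)
    qed
  qed
  moreover have "AE x in gauss_measure N. \<forall>m. (\<lambda>n. (\<Sum>k<n. h m ((?T ^^ k) x) - h (Suc m) ((?T ^^ k) x)) / real n) \<longlonglongrightarrow> 0"
    unfolding AE_all_countable
  proof
    fix m
    have b: "\<bar>h m s\<bar> \<le> hi" if "s \<in> {0..1}" for m s using hb[OF that, of m] lo by auto
    show "AE x in gauss_measure N. (\<lambda>n. (\<Sum>k<n. h m ((?T ^^ k) x) - h (Suc m) ((?T ^^ k) x)) / real n) \<longlonglongrightarrow> 0"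
      unfolding hSuc
    proof (rule AE_average_diff_transfer[OF N])
      show "integrable (gauss_measure N) (\<lambda>x. (h m x)\<^sup>2)"
      proof (rule integrable_const_bound)
        show "AE x in gauss_measure N. norm ((h m x)\<^sup>2) \<le> hi\<^sup>2"
          using AE_gauss_measure
          by eventually_elim (use b[of _ m] in \<open>auto simp: abs_le_square_iff[symmetric] intro: order.trans[OF _ abs_ge_self]\<close>)
      qed simp
      show "summable (\<lambda>j. weight N s j * h m (branch N s j))" if "s \<in> {0..<1}" for s
        using that b by (intro transfer_summable_bounded[OF N, where C=hi]) auto
      show "0 \<le> h m x" if "x \<in> {0<..1}" for x using hb[of x m] lo that by auto
      show "\<bar>gauss_transfer N (h m) s\<bar> \<le> hi" if "s \<in> {0..<1}" for s
        using b[of s "Suc m"] that by (simp add: hSuc)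
    qed simp
  qed
  ultimately have "AE x in gauss_measure N. (\<lambda>n. (\<Sum>k<n. f ((?T ^^ k) x)) / real n) \<longlonglongrightarrow> c"
    using AE_gauss_map_iter[OF N]
  proof eventually_elim
    case (elim x)
    have diff: "(\<lambda>n. (\<Sum>k<n. f ((?T ^^ k) x) - h m ((?T ^^ k) x)) / real n) \<longlonglongrightarrow> 0" for m
    proof (induction m)
      case 0
      then show ?case by (rule elim(1))
    next
      case (Suc m)
      have "(\<lambda>n. (\<Sum>k<n. f ((?T ^^ k) x) - h m ((?T ^^ k) x)) / real n +
          (\<Sum>k<n. h m ((?T ^^ k) x) - h (Suc m) ((?T ^^ k) x)) / real n) \<longlonglongrightarrow> 0 + 0"
        using elim(2) by (intro tendsto_add Suc.IH) blast
      then show ?case by (simp add: add_divide_distrib[symmetric] sum.distrib[symmetric])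
    qed
    show ?case
    proof (rule LIMSEQ_I)
      fix e :: real assume e: "e > 0"
      have "(\<lambda>m. (7/8)^m * L) \<longlonglongrightarrow> 0" by (rule summable_LIMSEQ_zero[OF geo])
      then have "\<forall>\<^sub>F m in sequentially. (7/8)^m * L < e / 3" using e by (intro order_tendstoD) auto
      moreover have "\<forall>\<^sub>F m in sequentially. \<bar>h m 0 - c\<bar> < e / 3"
        using tendstoD[OF c, of "e / 3"] e by (simp add: dist_real_def)
      ultimately have "\<forall>\<^sub>F m in sequentially. (7/8)^m * L < e / 3 \<and> \<bar>h m 0 - c\<bar> < e / 3"
        by eventually_elim auto
      then obtain m where m: "(7/8)^m * L < e / 3" "\<bar>h m 0 - c\<bar> < e / 3"
        by (auto simp: eventually_at_top_linorder)
      have "\<forall>\<^sub>F n in sequentially. \<bar>(\<Sum>k<n. f ((?T ^^ k) x) - h m ((?T ^^ k) x)) / real n\<bar> < e / 3"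
        using tendstoD[OF diff[of m], of "e / 3"] e by (simp add: dist_real_def)
      then have "\<forall>\<^sub>F n in sequentially. \<bar>(\<Sum>k<n. f ((?T ^^ k) x)) / real n - c\<bar> < e"
        using eventually_gt_at_top[of 0]
      proof eventually_elim
        case (elim n)
        have "\<bar>h m ((?T ^^ k) x) - c\<bar> \<le> 2 * e / 3" for k
        proof -
          have "(?T ^^ k) x \<in> {0..1}" using \<open>\<forall>k. (?T ^^ k) x \<in> {0<..<1}\<close> by (auto simp: less_imp_le)
          from osc[OF this, of m] show ?thesis using m by linarith
        qed
        then have "\<bar>\<Sum>k<n. h m ((?T ^^ k) x) - c\<bar> \<le> (\<Sum>k<n. 2 * e / 3)"
          by (intro order.trans[OF sum_abs] sum_mono)
        then have "\<bar>(\<Sum>k<n. h m ((?T ^^ k) x) - c) / real n\<bar> \<le> 2 * e / 3"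
          using elim by (simp add: divide_simps mult_ac)
        moreover have "(\<Sum>k<n. f ((?T ^^ k) x)) / real n - c =
            (\<Sum>k<n. f ((?T ^^ k) x) - h m ((?T ^^ k) x)) / real n + (\<Sum>k<n. h m ((?T ^^ k) x) - c) / real n"
          using elim by (simp add: sum_subtractf diff_divide_distrib)
        ultimately show ?case using elim by linarith
      qed
      then show "\<exists>n0. \<forall>n\<ge>n0. norm ((\<Sum>k<n. f ((?T ^^ k) x)) / real n - c) < e"
        by (simp add: eventually_at_top_linorder)
    qed
  qed
  with c_bounds show ?thesis by blast
qed

section \<open>Logarithmic observables\<close>

lemma ln_Suc_diff_bounds:
  fixes z :: real
  assumes "z > 0"
  shows "1 / (z + 1) \<le> ln (z + 1) - ln z" "ln (z + 1) - ln z \<le> 1 / z"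
  using ln_diff_le[of "z + 1" z] ln_diff_le[of z "z + 1"] assms by simp_all

text \<open>
  Summation by parts turns the series into \<open>ln (N+s)\<close> plus the sum of the tails times the increments of the logarithm.
  These products lie between the next and the current weight, so their sum
  lies between \<open>1 - w\<^sub>0\<close> and 1.
\<close>

lemma ln_weight_sums:
  assumes N: "N > 0" and s: "0 \<le> s"
  shows "\<exists>S. (\<lambda>j. weight N s j * ln (real N + real j + s)) sums S \<and>
    ln (real N + s) + (real N + s) / (real N + s + 1) \<le> S \<and> S \<le> ln (real N + s) + 1"
proof -
  define y where "y = real N + s"
  have y: "y \<ge> 1" using N s by (simp add: y_def)
  define v where "v j = ln (y + real j)" for j :: nat
  define d where "d j = weight_tail N s (Suc j) * (v (Suc j) - v j)" for j
  have t: "weight_tail N s j = y / (y + j)" for j by (simp add: weight_tail_def y_def add_ac)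
  have w: "weight N s j = y / ((y + j) * (y + j + 1))" for j by (simp add: weight_def y_def add_ac)
  have bounds: "weight N s (Suc j) \<le> d j \<and> d j \<le> weight N s j" for j
  proof
    have v: "1 / (y + j + 1) \<le> v (Suc j) - v j" "v (Suc j) - v j \<le> 1 / (y + j)"
      using ln_Suc_diff_bounds[of "y + j"] y by (simp_all add: v_def add_ac)
    have tp: "0 \<le> y / (y + j + 1)" using y by simp
    have d: "d j = y / (y + j + 1) * (v (Suc j) - v j)" by (simp add: d_def t add_ac)
    have "weight N s (Suc j) = y / ((y + j + 1) * (y + j + 2))" by (simp add: w add_ac)
    also have "\<dots> \<le> y / ((y + j + 1) * (y + j + 1))"
      using y by (intro divide_left_mono mult_left_mono mult_pos_pos) auto
    also have "\<dots> = y / (y + j + 1) * (1 / (y + j + 1))" by simp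
    also have "\<dots> \<le> d j" unfolding d by (intro mult_left_mono v tp)
    finally show "weight N s (Suc j) \<le> d j" .
    have "d j \<le> y / (y + j + 1) * (1 / (y + j))" unfolding d by (intro mult_left_mono v tp)
    then show "d j \<le> weight N s j" by (simp add: w mult.commute)
  qed
  have "summable d"
  proof (rule summable_comparison_test[OF _ sums_summable[OF weight_sums[OF N s]]])
    have "0 \<le> d j" for j using bounds[of j] weight_nonneg[OF s, of N "Suc j"] by linarith
    then show "\<exists>M. \<forall>n\<ge>M. norm (d n) \<le> weight N s n" using bounds by auto
  qed
  then have d: "d sums (suminf d)" by (rule summable_sums)
  have "y / (y + 1) \<le> suminf d"
    using sums_le[OF _ weight_Suc_sums[OF N s] d] bounds by (simp add: y_def)
  moreover have "suminf d \<le> 1"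
    using sums_le[OF _ d weight_sums[OF N s]] bounds by simp
  moreover have "(\<lambda>j. (weight_tail N s j - weight_tail N s (Suc j)) * v j) sums (weight_tail N s 0 * v 0 + suminf d)"
  proof (rule sums_by_parts)
    have "(\<lambda>j. y / (y + real j) * ln (y + real j)) \<longlonglongrightarrow> 0" by real_asymp
    then show "(\<lambda>j. weight_tail N s j * v j) \<longlonglongrightarrow> 0" by (simp add: t v_def)
    show "(\<lambda>j. weight_tail N s (Suc j) * (v (Suc j) - v j)) sums suminf d" using d by (simp add: d_def[abs_def])
  qed
  then have "(\<lambda>j. weight N s j * ln (real N + real j + s)) sums (ln y + suminf d)"
    using N s by (simp add: weight_eq_weight_tail_diff weight_tail_0 v_def y_def add_ac)
  ultimately show ?thesis unfolding y_def by (intro exI[of _ "ln y + suminf d"]) (auto simp: y_def)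
qed

text \<open>
  For \<open>\<theta> = 1\<close> this is the transfer operator applied to \<open>ln (N/x)\<close>, and for \<open>\<theta> = 0\<close>, on \<open>[0,1)\<close>, applied to
  \<open>ln \<lfloor>N/x\<rfloor>\<close>; the parameter lets one proof serve both.
\<close>

definition log_transfer :: "nat \<Rightarrow> real \<Rightarrow> real \<Rightarrow> real" where
  "log_transfer N \<theta> s = (\<Sum>j. weight N s j * ln (real N + real j + \<theta> * s))"

lemma log_transfer_measurable [measurable]: "log_transfer N \<theta> \<in> borel_measurable borel"
  unfolding log_transfer_def[abs_def] by measurable

context
  fixes N :: nat and \<theta> :: real
  assumes N: "N > 0" and \<theta>: "0 \<le> \<theta>" "\<theta> \<le> 1"
begin

lemma log_arg_ge:
  assumes "0 \<le> s"
  shows "1 \<le> real N + real j + \<theta> * s" "real N + real j \<le> real N + real j + \<theta> * s"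
    "real N + real j + \<theta> * s \<le> real N + real j + s"
proof -
  have "real N \<ge> 1" using N by simp
  then show "1 \<le> real N + real j + \<theta> * s" "real N + real j \<le> real N + real j + \<theta> * s"
    using \<theta> assms by (auto intro: add_increasing2)
  show "real N + real j + \<theta> * s \<le> real N + real j + s"
    using \<theta> assms by (simp add: mult_left_le_one_le)
qed

lemma log_transfer_summable:
  assumes s: "0 \<le> s"
  shows "summable (\<lambda>j. weight N s j * ln (real N + real j + \<theta> * s))"
proof -
  obtain S where "(\<lambda>j. weight N s j * ln (real N + real j + s)) sums S"
    using ln_weight_sums[OF N s] by blast
  then show ?thesis
  proof (rule summable_comparison_test[OF _ sums_summable, rotated])
    have "norm (weight N s j * ln (real N + real j + \<theta> * s)) \<le> weight N s j * ln (real N + real j + s)" for j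
      unfolding real_norm_def abs_mult using log_arg_ge[OF s, of j] weight_nonneg[OF s, of N j]
      by (intro mult_mono) auto
    then show "\<exists>M. \<forall>j\<ge>M. norm (weight N s j * ln (real N + real j + \<theta> * s)) \<le>
      weight N s j * ln (real N + real j + s)" by blast
  qed
qed

text \<open>
  The case \<open>\<theta> = 1\<close> is evaluated above, and lowering \<open>\<theta>\<close> costs at most \<open>1/N\<close> in every logarithm.
\<close>

lemma log_transfer_bounds:
  assumes s: "s \<in> {0..1}"
  shows "ln (real N) + real N / (real N + 1) - 1 / real N \<le> log_transfer N \<theta> s"
    and "log_transfer N \<theta> s \<le> ln (real N + 1) + 1"
    and "0 \<le> log_transfer N \<theta> s"
proof -
  have s0: "0 \<le> s" and s1: "s \<le> 1" using s by auto
  obtain S where S: "(\<lambda>j. weight N s j * ln (real N + real j + s)) sums S"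
    and lo: "ln (real N + s) + (real N + s) / (real N + s + 1) \<le> S" and hi: "S \<le> ln (real N + s) + 1"
    using ln_weight_sums[OF N s0] by blast
  have G: "(\<lambda>j. weight N s j * ln (real N + real j + \<theta> * s)) sums log_transfer N \<theta> s"
    unfolding log_transfer_def using log_transfer_summable[OF s0] by (rule summable_sums)
  have "log_transfer N \<theta> s \<le> S"
  proof (intro sums_le[OF _ G S] mult_left_mono weight_nonneg s0)
    show "ln (real N + real j + \<theta> * s) \<le> ln (real N + real j + s)" for j
      using log_arg_ge[OF s0, of j] by (subst ln_le_cancel_iff) linarith+
  qed
  moreover have "ln (real N + s) \<le> ln (real N + 1)" using s0 s1 N by simp
  ultimately show "log_transfer N \<theta> s \<le> ln (real N + 1) + 1" using hi by linarith
  show "0 \<le> log_transfer N \<theta> s"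
    unfolding log_transfer_def using log_arg_ge(1)[OF s0] weight_nonneg[OF s0]
    by (intro suminf_nonneg log_transfer_summable s0) auto
  have "S - 1 / real N \<le> log_transfer N \<theta> s"
  proof (rule sums_le)
    show "(\<lambda>j. weight N s j * ln (real N + real j + s) - weight N s j * (1 / real N)) sums (S - 1 / real N)"
      using sums_diff[OF S sums_mult2[OF weight_sums[OF N s0], of "1 / real N"]] by simp
    fix j
    let ?z = "real N + real j + \<theta> * s"
    have z: "1 \<le> ?z" "real N \<le> ?z" "?z \<le> real N + real j + s" using log_arg_ge[OF s0, of j] by auto
    have "ln (real N + real j + s) \<le> ln (?z + 1)"
      using z s1 log_arg_ge(2)[OF s0, of j] by (subst ln_le_cancel_iff) linarith+
    also have "\<dots> \<le> ln ?z + 1 / ?z" using ln_Suc_diff_bounds(2)[of ?z] z by simp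
    also have "1 / ?z \<le> 1 / real N" using z N by (intro divide_left_mono) auto
    finally have "ln (real N + real j + s) - 1 / real N \<le> ln ?z" by simp
    from mult_left_mono[OF this weight_nonneg[OF s0, of N j]]
    show "weight N s j * ln (real N + real j + s) - weight N s j * (1 / real N) \<le> weight N s j * ln ?z"
      by (simp only: right_diff_distrib)
  qed (rule G)
  moreover have "ln (real N) \<le> ln (real N + s)" using N s0 by simp
  moreover have "real N / (real N + 1) \<le> (real N + s) / (real N + s + 1)"
    using N s0 by (simp add: divide_simps) (simp add: algebra_simps)
  ultimately show "ln (real N) + real N / (real N + 1) - 1 / real N \<le> log_transfer N \<theta> s"
    using lo by linarith
qed

lemma log_transfer_lipschitz:
  assumes st: "s \<in> {0..1}" "t \<in> {0..1}"
  shows "\<bar>log_transfer N \<theta> s - log_transfer N \<theta> t\<bar> \<le> 2 * \<bar>s - t\<bar>"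
proof -
  have s: "0 \<le> s" and t: "0 \<le> t" "t \<le> 1" using st by auto
  have "\<bar>log_transfer N \<theta> s - log_transfer N \<theta> t\<bar> \<le> \<bar>s - t\<bar> + \<bar>s - t\<bar> / real N"
    unfolding log_transfer_def
  proof (rule weighted_sum_diff_le[OF N s t(1), where a="\<lambda>_. \<bar>s - t\<bar>" and b="\<lambda>j. \<bar>s - t\<bar> / real N * weight N 0 j"])
    show "summable (\<lambda>j. weight N s j * ln (real N + real j + \<theta> * s))"
      "summable (\<lambda>j. weight N t j * ln (real N + real j + \<theta> * t))"
      by (rule log_transfer_summable; fact)+
    show "(\<lambda>j. weight N s j * \<bar>s - t\<bar>) sums \<bar>s - t\<bar>"
      using sums_mult2[OF weight_sums[OF N s], of "\<bar>s - t\<bar>"] by simp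
    show "(\<lambda>j. \<bar>s - t\<bar> / real N * weight N 0 j) sums (\<bar>s - t\<bar> / real N)"
      using sums_mult[OF weight_sums[OF N order_refl], of "\<bar>s - t\<bar> / real N"] by simp
    show "\<bar>ln (real N + real j + \<theta> * s) - ln (real N + real j + \<theta> * t)\<bar> \<le> \<bar>s - t\<bar>" for j
    proof -
      have diff: "ln (real N + real j + \<theta> * a) - ln (real N + real j + \<theta> * b) \<le> \<bar>a - b\<bar>"
        if "0 \<le> a" "0 \<le> b" for a b
      proof -
        let ?z = "real N + real j + \<theta> * a" and ?w = "real N + real j + \<theta> * b"
        have p: "1 \<le> ?z" "1 \<le> ?w" using log_arg_ge(1) that by auto
        then have "ln ?z - ln ?w \<le> (?z - ?w) / ?w" by (intro ln_diff_le) linarith+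
        also have "\<dots> \<le> \<bar>(?z - ?w) / ?w\<bar>" by (rule abs_ge_self)
        also have "\<dots> = \<bar>?z - ?w\<bar> / ?w" using p by (simp add: abs_divide)
        also have "\<dots> \<le> \<bar>?z - ?w\<bar> / 1" using p by (intro divide_left_mono) auto
        also have "\<dots> = \<theta> * \<bar>a - b\<bar>" using \<theta> by (simp add: abs_mult flip: right_diff_distrib)
        also have "\<dots> \<le> \<bar>a - b\<bar>" using \<theta> by (simp add: mult_left_le_one_le)
        finally show ?thesis .
      qed
      show ?thesis using diff[OF s t(1)] diff[OF t(1) s] by (simp add: abs_le_iff abs_minus_commute)
    qed
    show "\<bar>(weight_tail N s (Suc j) - weight_tail N t (Suc j)) *
        (ln (real N + real (Suc j) + \<theta> * t) - ln (real N + real j + \<theta> * t))\<bar>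
        \<le> \<bar>s - t\<bar> / real N * weight N 0 j" for j
    proof -
      let ?z = "real N + real j + \<theta> * t"
      have z: "1 \<le> ?z" "real N + real j \<le> ?z" using log_arg_ge[OF t(1), of j] by auto
      have "0 \<le> 1 / (?z + 1)" using z by simp
      then have "\<bar>ln (?z + 1) - ln ?z\<bar> \<le> 1 / ?z" using ln_Suc_diff_bounds[of ?z] z by linarith
      also have "\<dots> \<le> 1 / (real N + real j)" using z N by (intro divide_left_mono) auto
      finally have "\<bar>ln (?z + 1) - ln ?z\<bar> \<le> 1 / (real N + real j)" .
      then have "\<bar>weight_tail N s (Suc j) - weight_tail N t (Suc j)\<bar> * \<bar>ln (?z + 1) - ln ?z\<bar>
        \<le> \<bar>s - t\<bar> / (real N + real (Suc j)) * (1 / (real N + real j))"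
        by (intro mult_mono abs_weight_tail_diff_le N s t) auto
      also have "\<dots> = \<bar>s - t\<bar> / real N * weight N 0 j" using N by (simp add: weight_def add_ac mult.commute)
      finally show ?thesis unfolding abs_mult by (simp add: add_ac)
    qed
    show "(\<lambda>j. (weight_tail N s j - weight_tail N t j) * ln (real N + real j + \<theta> * t)) \<longlonglongrightarrow> 0"
    proof (rule Lim_null_comparison)
      show "(\<lambda>j. \<bar>s - t\<bar> / (real N + real j) * ln (real N + real j + 1)) \<longlonglongrightarrow> 0"
        by real_asymp
      have "\<bar>weight_tail N s j - weight_tail N t j\<bar> * \<bar>ln (real N + real j + \<theta> * t)\<bar>
        \<le> \<bar>s - t\<bar> / (real N + real j) * ln (real N + real j + 1)" for j
      proof (intro mult_mono abs_weight_tail_diff_le N s t)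
        show "\<bar>ln (real N + real j + \<theta> * t)\<bar> \<le> ln (real N + real j + 1)"
          using log_arg_ge[OF t(1), of j] t(2) by (subst abs_of_nonneg) auto
      qed auto
      then show "\<forall>\<^sub>F j in sequentially. norm ((weight_tail N s j - weight_tail N t j) * ln (real N + real j + \<theta> * t))
          \<le> \<bar>s - t\<bar> / (real N + real j) * ln (real N + real j + 1)"
        by (simp add: abs_mult)
    qed
  qed
  also have "\<bar>s - t\<bar> / real N \<le> \<bar>s - t\<bar> / 1" using N by (intro divide_left_mono) auto
  finally show ?thesis by simp
qed

end

text \<open>
  \<open>(ln (N/x))\<^sup>2\<close> is at most a constant times \<open>x powr (-1/2)\<close>, which is integrable at 0.
\<close>

lemma integrable_ln_sq:
  assumes N: "N > 0"
  shows "integrable (gauss_measure N) (\<lambda>x. (ln (real N / x))\<^sup>2)"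
proof -
  have "integrable (gauss_measure N) (\<lambda>x. x powr (-1/2))"
  proof (rule integrableI_nonneg)
    have "(\<integral>\<^sup>+x. ennreal (x powr (-1/2)) \<partial>gauss_measure N) =
        (\<integral>\<^sup>+x. ennreal (indicator {0<..1} x / (real N + x)) * ennreal (x powr (-1/2)) \<partial>lborel)"
      unfolding gauss_measure_def by (subst nn_integral_density) auto
    also have "\<dots> \<le> (\<integral>\<^sup>+x. ennreal (if x \<in> {0..1} then x powr (-1/2) else 0) \<partial>lborel)"
    proof (intro nn_integral_mono)
      fix x :: real
      have "x powr (-1/2) / (real N + x) \<le> x powr (-1/2) / 1" if "0 < x"
        using that N by (intro divide_left_mono) auto
      then have "indicator {0<..1} x / (real N + x) * x powr (-1/2) \<le> (if x \<in> {0..1} then x powr (-1/2) else 0)"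
        by (auto simp: indicator_def)
      then show "ennreal (indicator {0<..1} x / (real N + x)) * ennreal (x powr (-1/2)) \<le>
          ennreal (if x \<in> {0..1} then x powr (-1/2) else 0)"
        by (subst ennreal_mult''[symmetric]) (auto intro!: ennreal_leI)
    qed
    also have "\<dots> = ennreal 2"
    proof (rule nn_integral_has_integral_lborel)
      have "((\<lambda>x. x powr (-1/2)) has_integral (1 powr (-1/2+1) / (-1/2+1))) {0..1::real}"
        by (intro has_integral_powr_from_0) auto
      then show "((\<lambda>x::real. if x \<in> {0..1} then x powr (-1/2) else 0) has_integral 2) UNIV"
        by (subst has_integral_restrict_UNIV) simp
    qed auto
    finally show "(\<integral>\<^sup>+x. ennreal (x powr (-1/2)) \<partial>gauss_measure N) < \<infinity>"
      by (auto simp: less_top[symmetric] top_unique)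
  qed auto
  then have "integrable (gauss_measure N) (\<lambda>x. 16 * sqrt (real N) * x powr (-1/2))" by simp
  then show ?thesis
  proof (rule Bochner_Integration.integrable_bound)
    show "AE x in gauss_measure N. norm ((ln (real N / x))\<^sup>2) \<le> norm (16 * sqrt (real N) * x powr (-1/2))"
      using AE_gauss_measure
    proof eventually_elim
      case (elim x)
      have z: "1 \<le> real N / x" using elim N by simp
      have "ln (real N / x) \<le> (real N / x) powr (1/4) / (1/4)" using z by (intro ln_powr_bound) auto
      then have "(ln (real N / x))\<^sup>2 \<le> (4 * (real N / x) powr (1/4))\<^sup>2" using z by (intro power_mono) auto
      also have "\<dots> = 16 * (real N / x) powr (1/2)"
        by (simp add: power_mult_distrib power2_eq_square flip: powr_add)
      also have "\<dots> = 16 * sqrt (real N) * x powr (-1/2)"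
        using elim N by (simp add: powr_divide powr_half_sqrt powr_minus_divide)
      finally show ?case using N by simp
    qed
  qed simp
qed

lemma floor_branch_ratio:
  assumes N: "N > 0" and s: "s \<in> {0..<1}"
  shows "real N / branch N s j = real N + real j + s" "real_of_int \<lfloor>real N / branch N s j\<rfloor> = real N + real j"
proof -
  show e: "real N / branch N s j = real N + real j + s" using N by (simp add: branch_def)
  have "\<lfloor>real N + real j + s\<rfloor> = int N + int j" using s by (intro floor_unique) auto
  then show "real_of_int \<lfloor>real N / branch N s j\<rfloor> = real N + real j" unfolding e by simp
qed

text \<open>
  The lower bound for \<open>c\<close> is negative for \<open>N = 1\<close>, while the averaging theorem wants a nonnegative one; it is
  therefore applied with the maximum of this bound and 0.
\<close>

lemma AE_log_average:
  assumes N: "N > 0" and \<theta>: "0 \<le> \<theta>" "\<theta> \<le> 1"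
    and f [measurable]: "f \<in> borel_measurable borel"
    and f_branch: "\<And>s j. s \<in> {0..<1} \<Longrightarrow> f (branch N s j) = ln (real N + real j + \<theta> * s)"
    and f_bounds: "\<And>x. x \<in> {0<..1} \<Longrightarrow> 0 \<le> f x \<and> f x \<le> ln (real N / x)"
  shows "\<exists>c. ln (real N) + real N / (real N + 1) - 1 / real N \<le> c \<and> c \<le> ln (real N + 1) + 1 \<and>
    (AE x in gauss_measure N. (\<lambda>n. (\<Sum>k<n. f ((gauss_map N ^^ k) x)) / real n) \<longlonglongrightarrow> c)"
proof -
  have "\<exists>c. max 0 (ln (real N) + real N / (real N + 1) - 1 / real N) \<le> c \<and> c \<le> ln (real N + 1) + 1 \<and>
    (AE x in gauss_measure N. (\<lambda>n. (\<Sum>k<n. f ((gauss_map N ^^ k) x)) / real n) \<longlonglongrightarrow> c)"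
  proof (rule AE_ergodic_average[OF N f])
    show "0 \<le> f x" if "x \<in> {0<..1}" for x using f_bounds[OF that] by simp
    show "summable (\<lambda>j. weight N s j * f (branch N s j))" if "s \<in> {0..<1}" for s
      using log_transfer_summable[OF N \<theta>, of s] that by (simp add: f_branch[OF that])
    show "gauss_transfer N f s = log_transfer N \<theta> s" if "s \<in> {0..<1}" for s
      by (simp add: gauss_transfer_def log_transfer_def f_branch[OF that])
    show "\<bar>log_transfer N \<theta> s - log_transfer N \<theta> t\<bar> \<le> 2 * \<bar>s - t\<bar>" if "s \<in> {0..1}" "t \<in> {0..1}" for s t
      using log_transfer_lipschitz[OF N \<theta> that] .
    show "max 0 (ln (real N) + real N / (real N + 1) - 1 / real N) \<le> log_transfer N \<theta> s \<and>
        log_transfer N \<theta> s \<le> ln (real N + 1) + 1" if "s \<in> {0..1}" for s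
      using log_transfer_bounds[OF N \<theta> that] by simp
    show "integrable (gauss_measure N) (\<lambda>x. (f x)\<^sup>2)"
    proof (rule Bochner_Integration.integrable_bound[OF integrable_ln_sq[OF N]])
      show "AE x in gauss_measure N. norm ((f x)\<^sup>2) \<le> norm ((ln (real N / x))\<^sup>2)"
        using AE_gauss_measure
        by eventually_elim (use f_bounds in \<open>auto intro!: power_mono\<close>)
    qed simp
  qed auto
  then show ?thesis by auto
qed

lemma AE_log_quotient_average:
  assumes N: "N > 0"
  shows "\<exists>c. ln (real N) + real N / (real N + 1) - 1 / real N \<le> c \<and> c \<le> ln (real N + 1) + 1 \<and>
    (AE x in gauss_measure N. (\<lambda>n. (\<Sum>k<n. ln (real N / (gauss_map N ^^ k) x)) / real n) \<longlonglongrightarrow> c)"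
proof (rule AE_log_average[OF N, where \<theta>=1])
  show "ln (real N / branch N s j) = ln (real N + real j + 1 * s)" if "s \<in> {0..<1}" for s j
    by (simp add: floor_branch_ratio(1)[OF N that])
  have "1 \<le> real N / x" if "x \<in> {0<..1}" for x using that N by simp
  then show "0 \<le> ln (real N / x) \<and> ln (real N / x) \<le> ln (real N / x)" if "x \<in> {0<..1}" for x
    using that by simp
qed auto

lemma AE_log_digit_average:
  assumes N: "N > 0"
  shows "\<exists>c. ln (real N) + real N / (real N + 1) - 1 / real N \<le> c \<and> c \<le> ln (real N + 1) + 1 \<and>
    (AE x in gauss_measure N. (\<lambda>n. (\<Sum>k<n. ln (real_of_int \<lfloor>real N / (gauss_map N ^^ k) x\<rfloor>)) / real n) \<longlonglongrightarrow> c)"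
proof (rule AE_log_average[OF N, where \<theta>=0])
  show "ln (real_of_int \<lfloor>real N / branch N s j\<rfloor>) = ln (real N + real j + 0 * s)" if "s \<in> {0..<1}" for s j
    by (simp add: floor_branch_ratio(2)[OF N that])
  have "1 \<le> real N / x" if "x \<in> {0<..1}" for x using that N by simp
  then have "1 \<le> real_of_int \<lfloor>real N / x\<rfloor>" if "x \<in> {0<..1}" for x using that by force
  then show "0 \<le> ln (real_of_int \<lfloor>real N / x\<rfloor>) \<and> ln (real_of_int \<lfloor>real N / x\<rfloor>) \<le> ln (real N / x)"
    if "x \<in> {0<..1}" for x using that by (smt (verit) ln_ge_zero ln_le_cancel_iff of_int_floor_le)
qed auto

section \<open>Coefficients and denominators along an orbit\<close>

text \<open>
  The density is positive on \<open>(0,1]\<close>, so the two measures have the same null sets in \<open>(0,1)\<close>.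
\<close>

lemma AE_lebesgue_on_if_AE_gauss_measure:
  assumes N: "N > 0" and ae: "AE x in gauss_measure N. P x"
  shows "AE x in lebesgue_on {0..<1}. P x"
proof -
  have "AE x in lborel. 0 < ennreal (indicator {0<..1} x / (real N + x)) \<longrightarrow> P x"
    using ae unfolding gauss_measure_def by (subst (asm) AE_density) auto
  then have "AE x in lborel. x \<in> {0..<1} \<longrightarrow> P x"
    using AE_lborel_singleton[of 0]
  proof eventually_elim
    case (elim x)
    have "0 < indicator {0<..1} x / (real N + x)" if "x \<in> {0..<1}"
      using that elim(2) N by auto
    then show ?case using elim(1) by (simp add: ennreal_less_zero_iff)
  qed
  then have "AE x in lebesgue. x \<in> {0..<1} \<longrightarrow> P x" by (rule AE_completion)
  then show ?thesis by (subst AE_restrict_space_iff) auto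
qed

context
  fixes N :: nat and x :: real
  assumes N: "N > 0" and orbit: "\<And>k. (gauss_map N ^^ k) x \<in> {0<..<1}"
begin

lemma quotient_orbit:
  obtains d where "cf_coeff N x (Suc k) = enat d" "d \<ge> 1"
    "real d = real_of_int \<lfloor>real N / (gauss_map N ^^ k) x\<rfloor>"
    "real N / (gauss_map N ^^ k) x = real d + (gauss_map N ^^ Suc k) x"
proof
  define y where "y = (gauss_map N ^^ k) x"
  have y: "0 < y" "y < 1" using orbit[of k] by (auto simp: y_def)
  define d where "d = nat \<lfloor>real N / y\<rfloor>"
  have "1 \<le> real N / y" using y N by simp
  then have "1 \<le> \<lfloor>real N / y\<rfloor>" by simp
  then show "d \<ge> 1" "real d = real_of_int \<lfloor>real N / (gauss_map N ^^ k) x\<rfloor>"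
    by (auto simp: d_def y_def[symmetric] le_nat_iff)
  show "cf_coeff N x (Suc k) = enat d" using y by (simp add: cf_coeff_def d_def y_def)
  have "(gauss_map N ^^ Suc k) x = frac (real N / y)" using y by (simp add: gauss_map_def y_def)
  then show "real N / (gauss_map N ^^ k) x = real d + (gauss_map N ^^ Suc k) x"
    using \<open>real d = _\<close> by (simp add: frac_def y_def)
qed

lemma root_prod_coeff:
  assumes n: "n > 0"
  shows "root_enat n (\<Prod>k=1..n. cf_coeff N x k) =
    ereal (exp ((\<Sum>k<n. ln (real_of_int \<lfloor>real N / (gauss_map N ^^ k) x\<rfloor>)) / real n))"
proof -
  have "\<exists>p. (\<Prod>k=1..m. cf_coeff N x k) = enat p \<and> p \<ge> 1 \<and>
      ln (real p) = (\<Sum>k<m. ln (real_of_int \<lfloor>real N / (gauss_map N ^^ k) x\<rfloor>))" for m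
  proof (induction m)
    case 0
    show ?case by (auto simp: one_enat_def)
  next
    case (Suc m)
    then obtain p where p: "(\<Prod>k=1..m. cf_coeff N x k) = enat p" "p \<ge> 1"
      "ln (real p) = (\<Sum>k<m. ln (real_of_int \<lfloor>real N / (gauss_map N ^^ k) x\<rfloor>))" by blast
    obtain d where d: "cf_coeff N x (Suc m) = enat d" "d \<ge> 1"
      "real d = real_of_int \<lfloor>real N / (gauss_map N ^^ m) x\<rfloor>"
      using quotient_orbit[of m] by metis
    show ?case
    proof (intro exI conjI)
      show "(\<Prod>k=1..Suc m. cf_coeff N x k) = enat (p * d)" using p d by simp
      show "p * d \<ge> 1" using p d by (simp add: Suc_leI)
      show "ln (real (p * d)) = (\<Sum>k<Suc m. ln (real_of_int \<lfloor>real N / (gauss_map N ^^ k) x\<rfloor>))"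
        using p d by (simp add: ln_mult)
    qed
  qed
  then obtain p where p: "(\<Prod>k=1..n. cf_coeff N x k) = enat p" "p \<ge> 1"
      "ln (real p) = (\<Sum>k<n. ln (real_of_int \<lfloor>real N / (gauss_map N ^^ k) x\<rfloor>))" by blast
  have "root n (real p) = exp (ln (root n (real p)))" using p n by simp
  also have "ln (root n (real p)) = ln (real p) / real n" using p n by (simp add: ln_root)
  finally show ?thesis using p by (simp add: root_enat_def)
qed

text \<open>
  Passing from \<open>n\<close> to \<open>n + 1\<close> multiplies both sides of the identity by \<open>N / T\<^sup>n\<^sup>+\<^sup>1 x = a\<^sub>n\<^sub>+\<^sub>2 + T\<^sup>n\<^sup>+\<^sup>2 x\<close>,
  by the recursion for the denominators. The monotonicity then places the product
  between \<open>B\<^sub>n\<^sub>+\<^sub>1\<close> and \<open>2 B\<^sub>n\<^sub>+\<^sub>1\<close>.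
\<close>

lemma cf_den_orbit:
  "\<exists>b b'. cf_den N x n = enat b \<and> cf_den N x (Suc n) = enat b' \<and> 1 \<le> b \<and> b \<le> b' \<and>
    real b' + (gauss_map N ^^ Suc n) x * real b = (\<Prod>k<Suc n. real N / (gauss_map N ^^ k) x)"
proof (induction n)
  case 0
  obtain d where d: "cf_coeff N x (Suc 0) = enat d" "d \<ge> 1"
    "real N / (gauss_map N ^^ 0) x = real d + (gauss_map N ^^ Suc 0) x"
    using quotient_orbit[of 0] by metis
  show ?case using d by (intro exI[of _ 1] exI[of _ d]) (simp add: one_enat_def zero_enat_def)
next
  case (Suc n)
  then obtain b b' where b: "cf_den N x n = enat b" "cf_den N x (Suc n) = enat b'" "1 \<le> b" "b \<le> b'"
    "real b' + (gauss_map N ^^ Suc n) x * real b = (\<Prod>k<Suc n. real N / (gauss_map N ^^ k) x)" by blast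
  obtain d where d: "cf_coeff N x (Suc (Suc n)) = enat d" "d \<ge> 1"
    "real N / (gauss_map N ^^ Suc n) x = real d + (gauss_map N ^^ Suc (Suc n)) x"
    using quotient_orbit[of "Suc n"] by metis
  define y where "y = (gauss_map N ^^ Suc n) x"
  define z where "z = (gauss_map N ^^ Suc (Suc n)) x"
  have y: "y > 0" using orbit[of "Suc n"] by (simp add: y_def)
  have "(\<Prod>k<Suc (Suc n). real N / (gauss_map N ^^ k) x) = (real b' + y * real b) * (real N / y)"
    unfolding prod.lessThan_Suc[of _ "Suc n"] b(5)[symmetric] y_def ..
  also have "\<dots> = (real N / y) * real b' + real N * real b" using y by (simp add: field_simps)
  also have "\<dots> = real (d * b' + N * b) + z * real b'"
    using d(3) by (simp add: y_def[symmetric] z_def[symmetric] algebra_simps del: funpow.simps)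
  finally have eq: "real (d * b' + N * b) + z * real b' = (\<Prod>k<Suc (Suc n). real N / (gauss_map N ^^ k) x)" ..
  have "b' \<le> d * b' + N * b" using d(2) by (simp add: trans_le_add1)
  then show ?case
    using b d eq by (intro exI[of _ b'] exI[of _ "d * b' + N * b"]) (simp add: z_def)
qed

lemma ln_cf_den_orbit:
  obtains b where "cf_den N x (Suc n) = enat b"
    "\<bar>ln (real b) - (\<Sum>k<Suc n. ln (real N / (gauss_map N ^^ k) x))\<bar> \<le> ln 2"
proof -
  obtain b b' where b: "cf_den N x (Suc n) = enat b'" "1 \<le> b" "b \<le> b'"
    "real b' + (gauss_map N ^^ Suc n) x * real b = (\<Prod>k<Suc n. real N / (gauss_map N ^^ k) x)"
    using cf_den_orbit[of n] by blast
  define P where "P = (\<Prod>k<Suc n. real N / (gauss_map N ^^ k) x)"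
  have pos: "0 < real N / (gauss_map N ^^ k) x" for k using N orbit[of k] by auto
  have lnP: "ln P = (\<Sum>k<Suc n. ln (real N / (gauss_map N ^^ k) x))"
    unfolding P_def by (rule ln_prod) (simp, metis pos less_irrefl)
  have t: "0 < (gauss_map N ^^ Suc n) x" "(gauss_map N ^^ Suc n) x < 1" using orbit[of "Suc n"] by auto
  have "(gauss_map N ^^ Suc n) x * real b \<le> 1 * real b'"
    using t b by (intro mult_mono) auto
  moreover have "0 \<le> (gauss_map N ^^ Suc n) x * real b" using t by (simp del: funpow.simps)
  ultimately have "real b' \<le> P" "P \<le> 2 * real b'" unfolding P_def b(4)[symmetric] by linarith+
  moreover have "real b' \<ge> 1" using b by linarith
  ultimately have "ln (real b') \<le> ln P" "ln P \<le> ln (2 * real b')" by (subst ln_le_cancel_iff; linarith)+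
  then have "\<bar>ln (real b') - ln P\<bar> \<le> ln 2" using \<open>real b' \<ge> 1\<close> by (simp add: ln_mult)
  then show ?thesis using that b(1) unfolding lnP by blast
qed

lemma cf_den_growth_tendsto:
  assumes "(\<lambda>n. (\<Sum>k<n. ln (real N / (gauss_map N ^^ k) x)) / real n) \<longlonglongrightarrow> c"
  shows "(\<lambda>n. ln_enat (cf_den N x n) / ereal (real n)) \<longlonglongrightarrow> ereal c"
proof -
  define S where "S n = (\<Sum>k<n. ln (real N / (gauss_map N ^^ k) x))" for n
  define r where "r n = ln (real (the_enat (cf_den N x n)))" for n
  have r: "ln_enat (cf_den N x n) = ereal (r n) \<and> \<bar>r n - S n\<bar> \<le> ln 2" if n: "n > 0" for n
  proof -
    obtain m where m: "n = Suc m" using n gr0_implies_Suc by blast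
    obtain b where "cf_den N x n = enat b" "\<bar>ln (real b) - S n\<bar> \<le> ln 2"
      using ln_cf_den_orbit[of m] unfolding m S_def by metis
    then show ?thesis by (simp add: ln_enat_def r_def)
  qed
  have "(\<lambda>n. (r n - S n) / real n) \<longlonglongrightarrow> 0"
  proof (rule Lim_null_comparison)
    show "(\<lambda>n. ln 2 / real n) \<longlonglongrightarrow> 0" by real_asymp
    show "\<forall>\<^sub>F n in sequentially. norm ((r n - S n) / real n) \<le> ln 2 / real n"
      using eventually_gt_at_top[of 0] by eventually_elim (use r in \<open>auto simp: divide_right_mono\<close>)
  qed
  from tendsto_add[OF assms[folded S_def] this] have "(\<lambda>n. r n / real n) \<longlonglongrightarrow> c"
    by (simp add: add_divide_distrib[symmetric])
  then have "(\<lambda>n. ereal (r n / real n)) \<longlonglongrightarrow> ereal c" by simp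
  moreover have "\<forall>\<^sub>F n in sequentially. ereal (r n / real n) = ln_enat (cf_den N x n) / ereal (real n)"
    using eventually_gt_at_top[of 0] by eventually_elim (use r in auto)
  ultimately show ?thesis by (rule Lim_transform_eventually)
qed

lemma coeff_geometric_mean_tendsto:
  assumes "(\<lambda>n. (\<Sum>k<n. ln (real_of_int \<lfloor>real N / (gauss_map N ^^ k) x\<rfloor>)) / real n) \<longlonglongrightarrow> c"
  shows "(\<lambda>n. root_enat n (\<Prod>k=1..n. cf_coeff N x k)) \<longlonglongrightarrow> ereal (exp c)"
proof (rule Lim_transform_eventually)
  show "(\<lambda>n. ereal (exp ((\<Sum>k<n. ln (real_of_int \<lfloor>real N / (gauss_map N ^^ k) x\<rfloor>)) / real n)))
      \<longlonglongrightarrow> ereal (exp c)"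
    using assms by (intro tendsto_intros) auto
  show "\<forall>\<^sub>F n in sequentially.
      ereal (exp ((\<Sum>k<n. ln (real_of_int \<lfloor>real N / (gauss_map N ^^ k) x\<rfloor>)) / real n)) =
      root_enat n (\<Prod>k=1..n. cf_coeff N x k)"
    using eventually_gt_at_top[of 0] by eventually_elim (simp only: root_prod_coeff)
qed

end

section \<open>The lower bound for every point\<close>

text \<open>
  The powers of \<open>r\<close> solve the recursion with all coefficients equal to \<open>N\<close>; the factor \<open>N/r\<close> is what the
  initial values 1 and \<open>N\<close> permit. The bound is stated through a natural number \<open>b\<close>, because the
  denominator itself may be \<open>\<infinity>\<close>.
\<close>

lemma cf_den_exponential_lower_bound:
  assumes N: "N > 0" and x: "x \<in> {0..<1}"
    and r: "r\<^sup>2 = real N * r + real N" "r > 0"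
  shows "\<exists>b. enat b \<le> cf_den N x n \<and> real N / r * r ^ n \<le> real b"
proof (induction n rule: induct_nat_012)
  case 0
  have "real N * r < r * r" using r N by (simp add: power2_eq_square)
  then have "real N / r \<le> 1" using r(2) by simp
  then show ?case by (intro exI[of _ 1]) (simp add: one_enat_def)
next
  case 1
  show ?case using cf_coeff_ge[OF x, of N 1] r(2) by (intro exI[of _ N]) (simp add: zero_enat_def[symmetric])
next
  case (ge2 n)
  then obtain b0 b1 where b: "enat b0 \<le> cf_den N x n" "real N / r * r ^ n \<le> real b0"
    "enat b1 \<le> cf_den N x (Suc n)" "real N / r * r ^ Suc n \<le> real b1" by blast
  show ?case
  proof (intro exI conjI)
    have "enat (N * b1 + N * b0) = enat N * enat b1 + enat N * enat b0" by simp
    also have "\<dots> \<le> cf_den N x (Suc (Suc n))"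
      unfolding cf_den.simps using b by (intro add_mono mult_mono cf_coeff_ge x) auto
    finally show "enat (N * b1 + N * b0) \<le> cf_den N x (Suc (Suc n))" .
    have "real N / r * r ^ Suc (Suc n) = real N / r * r ^ n * r\<^sup>2" by (simp add: power2_eq_square)
    also have "\<dots> = real N * (real N / r * r ^ Suc n) + real N * (real N / r * r ^ n)"
      unfolding r(1) using r(2) by (simp add: field_simps)
    also have "\<dots> \<le> real N * real b1 + real N * real b0"
      using b by (intro add_mono mult_left_mono) auto
    finally show "real N / r * r ^ Suc (Suc n) \<le> real (N * b1 + N * b0)" by simp
  qed
qed

lemma liminf_cf_den_growth:
  assumes N: "N > 0" and x: "x \<in> {0..<1}"
  shows "liminf (\<lambda>n. ln_enat (cf_den N x n) / ereal (real n))
    \<ge> ereal (ln ((sqrt ((real N)\<^sup>2 + 4 * real N) + real N) / 2))"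
proof -
  define r where "r = (sqrt ((real N)\<^sup>2 + 4 * real N) + real N) / 2"
  have "(sqrt ((real N)\<^sup>2 + 4 * real N))\<^sup>2 = (real N)\<^sup>2 + 4 * real N" by simp
  then have "r\<^sup>2 = real N * r + real N" by (simp add: r_def power2_eq_square field_simps)
  moreover have r0: "r > 0" unfolding r_def using N by (intro divide_pos_pos add_nonneg_pos) auto
  ultimately have bound: "\<exists>b. enat b \<le> cf_den N x n \<and> real N / r * r ^ n \<le> real b" for n
    by (rule cf_den_exponential_lower_bound[OF N x])
  have "(\<lambda>n. ln (real N / r) / real n + ln r) \<longlonglongrightarrow> 0 + ln r"
    by (intro tendsto_add tendsto_const) real_asymp
  then have "(\<lambda>n. ereal (ln (real N / r) / real n + ln r)) \<longlonglongrightarrow> ereal (ln r)" by simp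
  then have "ereal (ln r) = liminf (\<lambda>n. ereal (ln (real N / r) / real n + ln r))"
    by (intro lim_imp_Liminf[symmetric]) auto
  also have "\<dots> \<le> liminf (\<lambda>n. ln_enat (cf_den N x n) / ereal (real n))"
  proof (rule Liminf_mono)
    show "\<forall>\<^sub>F n in sequentially. ereal (ln (real N / r) / real n + ln r) \<le> ln_enat (cf_den N x n) / ereal (real n)"
      using eventually_gt_at_top[of 0]
    proof eventually_elim
      case (elim n)
      obtain b where b: "enat b \<le> cf_den N x n" "real N / r * r ^ n \<le> real b" using bound by blast
      show ?case
      proof (cases "cf_den N x n")
        case infinity
        then show ?thesis using elim by (simp add: ln_enat_def)
      next
        case (enat m)
        have pos: "0 < real N / r * r ^ n" using N r0 by simp
        have le: "real N / r * r ^ n \<le> real m" using b enat by simp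
        have "ln (real N / r) + real n * ln r = ln (real N / r * r ^ n)"
          using N r0 by (subst ln_mult) (auto simp: ln_realpow)
        also have "\<dots> \<le> ln (real m)" using pos le by (subst ln_le_cancel_iff) linarith+
        finally have "(ln (real N / r) + real n * ln r) / real n \<le> ln (real m) / real n"
          by (intro divide_right_mono) auto
        then show ?thesis using elim enat by (simp add: ln_enat_def add_divide_distrib)
      qed
    qed
  qed
  finally show ?thesis unfolding r_def .
qed

section \<open>The limit theorems\<close>

text \<open>
  The common asymptotics of \<open>ln K\<^sub>N\<close> and \<open>L\<^sub>N\<close>.
\<close>

lemma tendsto_minus_ln_if_bounds:
  fixes c :: "nat \<Rightarrow> real"
  assumes "\<And>N. N > 0 \<Longrightarrow> ln (real N) + real N / (real N + 1) - 1 / real N \<le> c N \<and> c N \<le> ln (real N + 1) + 1"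
  shows "(\<lambda>N. c N - ln (real N)) \<longlonglongrightarrow> 1"
proof (rule tendsto_sandwich)
  show "(\<lambda>N. real N / (real N + 1) - 1 / real N) \<longlonglongrightarrow> 1" by real_asymp
  show "(\<lambda>N. ln (real N + 1) + 1 - ln (real N)) \<longlonglongrightarrow> 1" by real_asymp
  show "\<forall>\<^sub>F N in sequentially. real N / (real N + 1) - 1 / real N \<le> c N - ln (real N)"
    using eventually_gt_at_top[of 0]
  proof eventually_elim
    case (elim N)
    then show ?case using assms[of N] by linarith
  qed
  show "\<forall>\<^sub>F N in sequentially. c N - ln (real N) \<le> ln (real N + 1) + 1 - ln (real N)"
    using eventually_gt_at_top[of 0]
  proof eventually_elim
    case (elim N)
    then show ?case using assms[of N] by linarith
  qed
qed

theorem theorem1p4: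
  shows
    "(\<exists>K :: nat \<Rightarrow> real.
        (\<forall>N>0. AE x in lebesgue_on {0..<1}.
            (\<lambda>n. root_enat n (\<Prod>k=1..n. cf_coeff N x k)) \<longlonglongrightarrow> ereal (K N)) \<and>
        (\<lambda>N. K N / real N) \<longlonglongrightarrow> exp 1) \<and>
     (\<exists>L :: nat \<Rightarrow> real.
        (\<forall>N>0. AE x in lebesgue_on {0..<1}.
            (\<lambda>n. ln_enat (cf_den N x n) / ereal (real n)) \<longlonglongrightarrow> ereal (L N)) \<and>
        (\<lambda>N. L N - ln (real N)) \<longlonglongrightarrow> 1) \<and>
     (\<forall>N>0. \<forall>x\<in>{0..<1}.
        liminf (\<lambda>n. ln_enat (cf_den N x n) / ereal (real n))
          \<ge> ereal (ln ((sqrt ((real N)\<^sup>2 + 4 * real N) + real N) / 2)))"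
proof (intro conjI)
  define k where "k N = (SOME c. ln (real N) + real N / (real N + 1) - 1 / real N \<le> c \<and> c \<le> ln (real N + 1) + 1 \<and>
      (AE x in gauss_measure N. (\<lambda>n. (\<Sum>i<n. ln (real_of_int \<lfloor>real N / (gauss_map N ^^ i) x\<rfloor>)) / real n) \<longlonglongrightarrow> c))" for N
  have k: "ln (real N) + real N / (real N + 1) - 1 / real N \<le> k N \<and> k N \<le> ln (real N + 1) + 1 \<and>
      (AE x in gauss_measure N. (\<lambda>n. (\<Sum>i<n. ln (real_of_int \<lfloor>real N / (gauss_map N ^^ i) x\<rfloor>)) / real n) \<longlonglongrightarrow> k N)" if "N > 0" for N
    unfolding k_def by (rule someI_ex) (rule AE_log_digit_average[OF that])
  show "\<exists>K :: nat \<Rightarrow> real. (\<forall>N>0. AE x in lebesgue_on {0..<1}.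
            (\<lambda>n. root_enat n (\<Prod>k=1..n. cf_coeff N x k)) \<longlonglongrightarrow> ereal (K N)) \<and>
        (\<lambda>N. K N / real N) \<longlonglongrightarrow> exp 1"
  proof (intro exI[of _ "\<lambda>N. exp (k N)"] conjI allI impI)
    fix N :: nat assume N: "N > 0"
    have "AE x in gauss_measure N. (\<lambda>n. root_enat n (\<Prod>k=1..n. cf_coeff N x k)) \<longlonglongrightarrow> ereal (exp (k N))"
      using k[OF N, THEN conjunct2, THEN conjunct2] AE_gauss_map_iter[OF N]
      by eventually_elim (use coeff_geometric_mean_tendsto[OF N] in blast)
    then show "AE x in lebesgue_on {0..<1}. (\<lambda>n. root_enat n (\<Prod>k=1..n. cf_coeff N x k)) \<longlonglongrightarrow> ereal (exp (k N))"
      by (rule AE_lebesgue_on_if_AE_gauss_measure[OF N])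
  next
    have "(\<lambda>N. exp (k N - ln (real N))) \<longlonglongrightarrow> exp 1"
      using k by (intro tendsto_exp tendsto_minus_ln_if_bounds) blast
    moreover have "\<forall>\<^sub>F N in sequentially. exp (k N - ln (real N)) = exp (k N) / real N"
      using eventually_gt_at_top[of 0] by eventually_elim (simp add: exp_diff)
    ultimately show "(\<lambda>N. exp (k N) / real N) \<longlonglongrightarrow> exp 1" by (rule Lim_transform_eventually)
  qed
next
  define l where "l N = (SOME c. ln (real N) + real N / (real N + 1) - 1 / real N \<le> c \<and> c \<le> ln (real N + 1) + 1 \<and>
      (AE x in gauss_measure N. (\<lambda>n. (\<Sum>i<n. ln (real N / (gauss_map N ^^ i) x)) / real n) \<longlonglongrightarrow> c))" for N
  have l: "ln (real N) + real N / (real N + 1) - 1 / real N \<le> l N \<and> l N \<le> ln (real N + 1) + 1 \<and>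
      (AE x in gauss_measure N. (\<lambda>n. (\<Sum>i<n. ln (real N / (gauss_map N ^^ i) x)) / real n) \<longlonglongrightarrow> l N)" if "N > 0" for N
    unfolding l_def by (rule someI_ex) (rule AE_log_quotient_average[OF that])
  show "\<exists>L :: nat \<Rightarrow> real. (\<forall>N>0. AE x in lebesgue_on {0..<1}.
            (\<lambda>n. ln_enat (cf_den N x n) / ereal (real n)) \<longlonglongrightarrow> ereal (L N)) \<and>
        (\<lambda>N. L N - ln (real N)) \<longlonglongrightarrow> 1"
  proof (intro exI[of _ l] conjI allI impI)
    fix N :: nat assume N: "N > 0"
    have "AE x in gauss_measure N. (\<lambda>n. ln_enat (cf_den N x n) / ereal (real n)) \<longlonglongrightarrow> ereal (l N)"
      using l[OF N, THEN conjunct2, THEN conjunct2] AE_gauss_map_iter[OF N]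
      by eventually_elim (use cf_den_growth_tendsto[OF N] in blast)
    then show "AE x in lebesgue_on {0..<1}. (\<lambda>n. ln_enat (cf_den N x n) / ereal (real n)) \<longlonglongrightarrow> ereal (l N)"
      by (rule AE_lebesgue_on_if_AE_gauss_measure[OF N])
  next
    show "(\<lambda>N. l N - ln (real N)) \<longlonglongrightarrow> 1" using l by (intro tendsto_minus_ln_if_bounds) blast
  qed
next
  show "\<forall>N>0. \<forall>x\<in>{0..<1}. liminf (\<lambda>n. ln_enat (cf_den N x n) / ereal (real n))
          \<ge> ereal (ln ((sqrt ((real N)\<^sup>2 + 4 * real N) + real N) / 2))"
    using liminf_cf_den_growth by blast
qed

end
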